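(* Let $p\ge1$ and $L\ge m>0$. Then, for each $\rho\in(0,1]$, each $\Delta_\rho\in\mathbf{\Delta}_\rho(m,L)$ and each $\Pi\in\mathbf{\Pi}_{\Delta,\rho}^p(m,L)$, the operator $\Delta_\rho$ satisfies the IQC defined by $\Pi$.
   Context: $\mathbb{N}=\{0,1,2,\dots\}$. $\mathcal{S}_{m,L}$: functions $H:\mathbb{R}^p\to\mathbb{R}$, $H\in\mathcal{C}^2$, with $(\nabla H(x)-\nabla H(y))^\top(x-y)\ge m\|x-y\|^2$ and $\|\nabla H(x)-\nabla H(y)\|\le L\|x-y\|$ for all $x,y$; $z^\star$ is the unique minimizer of $H$. For a sequence $y=(y_k)_{k\in\mathbb{N}}$ in $\mathbb{R}^p$: $\Delta_H(y)_k=\nabla H(y_k+z^\star)-my_k$, $(\rho_+(y))_k=\rho^ky_k$, $(\rho_-(y))_k=\rho^{-k}y_k$, and $\mathbf{\Delta}_\rho(m,L)=\{\rho_-\circ\Delta_H\circ\rho_+\mid H\in\mathcal{S}_{m,L}\}$, regarded as operators $\ell_2^p\to\ell_2^p$ (one-sided square-summable sequences). An operator $\Delta:\ell_2^p\to\ell_2^p$ satisfies the IQC defined by $\Pi$ if for all $q\in\ell_2^p$ $$\int_0^{2\pi}\begin{bmatrix}\widehat q(e^{\mathrm{j}\omega})\\ \widehat{\Delta(q)}(e^{\mathrm{j}\omega})\end{bmatrix}^*\Pi(e^{\mathrm{j}\omega})\begin{bmatrix}\widehat q(e^{\mathrm{j}\omega})\\ \widehat{\Delta(q)}(e^{\mathrm{j}\omega})\end{bmatrix}\mathrm{d}\omega\ge0,$$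 where $\widehat q(z)=\sum_{k\ge0}q_kz^{-k}$ is the $z$-transform and $^*$ is conjugate transposition. $\mathbb{M}(\rho,\ell_+,\ell_-,p)$ is the set of block rows $[M_{-\ell_-}\ \cdots\ M_{\ell_+}]$ with $M_i=m_iI_p$, $m_i\in\mathbb{R}$, $m_i\le0$ for all $i\ne0$, $(\sum_{i=-\ell_-}^{\ell_+}M_i\rho^{-i})\mathbf{1}\ge0$, $\mathbf{1}^\top(\sum_{i=-\ell_-}^{\ell_+}M_i\rho^i)\ge0$ (elementwise, $\mathbf 1$ the all-ones vector). $\mathbf{\Pi}_{\Delta,\rho}^p(m,L)$ is the set of all $$\Pi=\widehat W^\top\begin{bmatrix}0&E^*\\ E&0\end{bmatrix}\widehat W,\qquad\widehat W=\begin{bmatrix}(L-m)I_p&-I_p\\ 0&I_p\end{bmatrix},$$ with $E(z)=\sum_{j=-\ell_-}^{\ell_+}M_jz^j$, $\ell_+,\ell_-\in\mathbb{N}$, $[M_{-\ell_-}\cdots M_{\ell_+}]\in\mathbb{M}(\rho,\ell_+,\ell_-,p)$. *)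

theory Defs
  imports "HOL-Analysis.Analysis" "HOL-Library.Complex_Order"
begin

section \<open>The function class\<close>

definition grad :: "(real^'n \<Rightarrow> real) \<Rightarrow> real^'n \<Rightarrow> real^'n" where
  "grad H x = (THE g. GDERIV H x :> g)"

text \<open>The second derivative is taken as the Frechet derivative of the gradient;
  its continuity is with respect to the operator norm.\<close>

definition C2 :: "(real^'n \<Rightarrow> real) \<Rightarrow> bool" where
  "C2 H \<longleftrightarrow> (\<forall>x. H differentiable (at x)) \<and>
     (\<exists>H2 :: real^'n \<Rightarrow> (real^'n) \<Rightarrow>\<^sub>L (real^'n).
        (\<forall>x. (grad H has_derivative blinfun_apply (H2 x)) (at x)) \<and> continuous_on UNIV H2)"

definition S_class :: "real \<Rightarrow> real \<Rightarrow> (real^'n \<Rightarrow> real) set" where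
  "S_class m L = {H. C2 H \<and>
     (\<forall>x y. (grad H x - grad H y) \<bullet> (x - y) \<ge> m * (norm (x - y))\<^sup>2) \<and>
     (\<forall>x y. norm (grad H x - grad H y) \<le> L * norm (x - y))}"

definition minimizer :: "(real^'n \<Rightarrow> real) \<Rightarrow> real^'n" where
  "minimizer H = (THE z. is_arg_min H (\<lambda>_. True) z)"


section \<open>Operators on sequences\<close>

definition ell2 :: "(nat \<Rightarrow> real^'n) set" where
  "ell2 = {q. summable (\<lambda>k. (norm (q k))\<^sup>2)}"

definition Delta_op :: "real \<Rightarrow> (real^'n \<Rightarrow> real) \<Rightarrow> (nat \<Rightarrow> real^'n) \<Rightarrow> (nat \<Rightarrow> real^'n)" where
  "Delta_op m H y = (\<lambda>k. grad H (y k + minimizer H) - m *\<^sub>R y k)"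

definition rho_plus :: "real \<Rightarrow> (nat \<Rightarrow> real^'n) \<Rightarrow> (nat \<Rightarrow> real^'n)" where
  "rho_plus \<rho> y = (\<lambda>k. \<rho> ^ k *\<^sub>R y k)"

definition rho_minus :: "real \<Rightarrow> (nat \<Rightarrow> real^'n) \<Rightarrow> (nat \<Rightarrow> real^'n)" where
  "rho_minus \<rho> y = (\<lambda>k. \<rho> powi (- int k) *\<^sub>R y k)"

definition Delta_set ::
    "real \<Rightarrow> real \<Rightarrow> real \<Rightarrow> ((nat \<Rightarrow> real^'n) \<Rightarrow> (nat \<Rightarrow> real^'n)) set" where
  "Delta_set \<rho> m L = {rho_minus \<rho> \<circ> Delta_op m H \<circ> rho_plus \<rho> | H. H \<in> S_class m L}"


section \<open>The z-transform on the unit circle\<close>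

text \<open>For a square-summable sequence the series need not converge absolutely on the unit
  circle; as usual it is understood there as a limit in \<open>L2\<close>, which exists (Riesz-Fischer) and is
  unique up to null sets. Since the distance is measured by the extended nonnegative integral,
  convergence to 0 already forces the limit to be square integrable.\<close>

definition is_ztransform :: "(nat \<Rightarrow> real^'n) \<Rightarrow> (complex \<Rightarrow> complex^'n) \<Rightarrow> bool" where
  "is_ztransform q f \<longleftrightarrow>
     set_borel_measurable lborel {0..2*pi} (\<lambda>\<omega>. f (cis \<omega>)) \<and>
     (\<lambda>N. \<integral>\<^sup>+\<omega>\<in>{0..2*pi}. ennreal ((norm (f (cis \<omega>) -
         (\<chi> i. \<Sum>k<N. complex_of_real (q k $ i) * cis \<omega> powi (- int k))))\<^sup>2) \<partial>lborel)
       \<longlonglongrightarrow> 0"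

definition ztransform :: "(nat \<Rightarrow> real^'n) \<Rightarrow> complex \<Rightarrow> complex^'n" where
  "ztransform q = (SOME f. is_ztransform q f)"


section \<open>Complex block matrices and integral quadratic constraints\<close>

definition ctranspose :: "complex^'a^'b \<Rightarrow> complex^'b^'a" where
  "ctranspose A = (\<chi> i j. cnj (A $ j $ i))"

definition block_vec :: "complex^'a \<Rightarrow> complex^'b \<Rightarrow> complex^('a + 'b)" where
  "block_vec x y = (\<chi> i. case i of Inl a \<Rightarrow> x $ a | Inr b \<Rightarrow> y $ b)"

definition block_mat :: "complex^'a^'c \<Rightarrow> complex^'b^'c \<Rightarrow> complex^'a^'d \<Rightarrow> complex^'b^'d \<Rightarrow>
    complex^('a + 'b)^('c + 'd)" where
  "block_mat A B C D =
     (\<chi> i. case i of Inl c \<Rightarrow> block_vec (A $ c) (B $ c) | Inr d \<Rightarrow> block_vec (C $ d) (D $ d))"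

text \<open>\<open>quad_form P v\<close> is \<open>v\<^sup>* P v\<close>.\<close>

definition quad_form :: "complex^'a^'a \<Rightarrow> complex^'a \<Rightarrow> complex" where
  "quad_form P v = (\<Sum>i\<in>UNIV. cnj (v $ i) * (P *v v) $ i)"

text \<open>The complex order makes \<open>0 \<le> z\<close> mean that \<open>z\<close> is real and nonnegative. Integrability is
  required explicitly because the library integral of a non-integrable function is 0.\<close>

definition satisfies_IQC ::
    "((nat \<Rightarrow> real^'n) \<Rightarrow> (nat \<Rightarrow> real^'n)) \<Rightarrow> (complex \<Rightarrow> complex^('n + 'n)^('n + 'n)) \<Rightarrow> bool" where
  "satisfies_IQC \<Delta> P \<longleftrightarrow> \<Delta> \<in> ell2 \<rightarrow> ell2 \<and>
     (\<forall>q\<in>ell2.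
        let f = (\<lambda>\<omega>. quad_form (P (cis \<omega>))
                       (block_vec (ztransform q (cis \<omega>)) (ztransform (\<Delta> q) (cis \<omega>))))
        in set_integrable lborel {0..2*pi} f \<and> 0 \<le> (LINT \<omega>:{0..2*pi}|lborel. f \<omega>))"


section \<open>The class of multipliers\<close>

text \<open>A block row \<open>[M\<^bsub>-lm\<^esub> \<dots> M\<^bsub>lp\<^esub>]\<close> is a function on the integers of which only the
  entries with index in \<open>{-lm..lp}\<close> matter.\<close>

definition M_set :: "real \<Rightarrow> nat \<Rightarrow> nat \<Rightarrow> (int \<Rightarrow> real^'n^'n) set" where
  "M_set \<rho> lp lm = {M.
     (\<exists>c :: int \<Rightarrow> real. (\<forall>i\<in>{- int lm..int lp}. M i = mat (c i)) \<and>
                        (\<forall>i\<in>{- int lm..int lp}. i \<noteq> 0 \<longrightarrow> c i \<le> 0)) \<and>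
     0 \<le> (\<Sum>i\<in>{- int lm..int lp}. \<rho> powi (- i) *\<^sub>R M i) *v 1 \<and>
     0 \<le> 1 v* (\<Sum>i\<in>{- int lm..int lp}. \<rho> powi i *\<^sub>R M i)}"

definition E_fun :: "nat \<Rightarrow> nat \<Rightarrow> (int \<Rightarrow> real^'n^'n) \<Rightarrow> complex \<Rightarrow> complex^'n^'n" where
  "E_fun lp lm M z =
     (\<chi> a b. \<Sum>j\<in>{- int lm..int lp}. complex_of_real (M j $ a $ b) * z powi j)"

definition W_mat :: "real \<Rightarrow> real \<Rightarrow> complex^('n::finite + 'n)^('n + 'n)" where
  "W_mat m L = block_mat (mat (complex_of_real (L - m))) (- mat 1) 0 (mat 1)"

text \<open>Multipliers are only evaluated on the unit circle, where the adjoint \<open>E\<^sup>*\<close> is the pointwise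
  conjugate transpose.\<close>

definition Pi_set :: "real \<Rightarrow> real \<Rightarrow> real \<Rightarrow> (complex \<Rightarrow> complex^('n::finite + 'n)^('n + 'n)) set" where
  "Pi_set \<rho> m L =
     {(\<lambda>z. transpose (W_mat m L) **
            block_mat 0 (ctranspose (E_fun lp lm M z)) (E_fun lp lm M z) 0 ** W_mat m L)
      | lp lm M. M \<in> M_set \<rho> lp lm}"

end

theory Submission
  imports Defs
begin

text \<open>Let \<open>g y = \<nabla>H (y + z) - m y\<close> with \<open>z\<close> the minimizer of \<open>H\<close>. Then \<open>g\<close> is the gradient of a convex function
  \<open>h\<close> with \<open>h 0 = 0\<close> whose gradient is \<open>(L - m)\<close>-Lipschitz; with \<open>u y = (L - m) y - g y\<close>, convexity gives
  \<open>g y \<bullet> (u y - u x) \<ge> V y - V x\<close> for the nonnegative function \<open>V = (L - m) h - |g|\<^sup>2 / 2\<close>.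
  By Parseval the quadratic constraint is a weighted sum, over the shifts \<open>j\<close>, of
  the correlations of \<open>g y\<^sub>k\<close> with \<open>u y\<^bsub>k+j\<^esub>\<close>. The inequality bounds each correlation with \<open>j \<noteq> 0\<close>, whose
  coefficient is nonpositive, by \<open>\<rho>\<^bsup>-j\<^esup> A + \<rho>\<^bsup>j\<^esup> B\<close>, where \<open>A, B \<ge> 0\<close> do not depend on \<open>j\<close> and
  \<open>A + B\<close> is the correlation for \<open>j = 0\<close>. The two row-sum conditions on the multiplier then give the
  claim. The inequality holds already for the correlations over a finite window, that is for the
  partial sums of the z-transforms, so the \<open>L2\<close> limit is taken only at the very end.\<close>

section \<open>Limits in \<open>L2\<close>\<close>

lemma norm_add_power2_le:
  fixes x y :: "'a::real_inner"
  shows "(norm (x + y))\<^sup>2 \<le> 2 * (norm x)\<^sup>2 + 2 * (norm y)\<^sup>2"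
proof -
  have "0 \<le> (norm (x - y))\<^sup>2" by simp
  then show ?thesis
    by (simp add: power2_norm_eq_inner inner_add_left inner_add_right inner_diff_left inner_diff_right inner_commute)
qed

text \<open>Young's inequality without its factor 1/2. The free weight \<open>s\<close> serves
  products in which one factor is merely bounded while the other tends to 0.\<close>

lemma abs_inner_le_weighted:
  fixes x y :: "'a::real_inner"
  assumes "0 < s"
  shows "\<bar>x \<bullet> y\<bar> \<le> s * (norm x)\<^sup>2 + (norm y)\<^sup>2 / s"
proof -
  have "0 \<le> (s * norm x - norm y)\<^sup>2" by simp
  then have "2 * (s * (norm x * norm y)) \<le> s * (s * (norm x)\<^sup>2 + (norm y)\<^sup>2 / s)"
    using assms by (simp add: power2_eq_square algebra_simps)
  then have "2 * (norm x * norm y) \<le> s * (norm x)\<^sup>2 + (norm y)\<^sup>2 / s"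
    using assms by (metis mult.left_commute mult_le_cancel_left_pos)
  moreover have "norm x * norm y \<le> 2 * (norm x * norm y)" by simp
  ultimately show ?thesis using Cauchy_Schwarz_ineq2[of x y] by linarith
qed

context
  fixes M :: "'a measure" and f :: "'a \<Rightarrow> 'b::euclidean_space" and F :: "nat \<Rightarrow> 'a \<Rightarrow> 'b"
  assumes f[measurable]: "f \<in> borel_measurable M"
    and F[measurable]: "\<And>n. F n \<in> borel_measurable M"
    and F2: "\<And>n. integrable M (\<lambda>x. (norm (F n x))\<^sup>2)"
    and lim: "(\<lambda>n. \<integral>\<^sup>+x. ennreal ((norm (f x - F n x))\<^sup>2) \<partial>M) \<longlonglongrightarrow> 0"
begin

text \<open>Some \<open>F n\<close> lies at finite distance from \<open>f\<close>, and
  \<open>f = (f - F n) + F n\<close>.\<close>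

lemma L2_limit_square_integrable: "integrable M (\<lambda>x. (norm (f x))\<^sup>2)"
proof -
  have "\<forall>\<^sub>F n in sequentially. (\<integral>\<^sup>+x. ennreal ((norm (f x - F n x))\<^sup>2) \<partial>M) < 1"
    using lim by (rule order_tendstoD) simp
  then obtain n where n: "(\<integral>\<^sup>+x. ennreal ((norm (f x - F n x))\<^sup>2) \<partial>M) < 1"
    by (auto simp: eventually_sequentially)
  have "integrable M (\<lambda>x. (norm (f x - F n x))\<^sup>2)"
    using n by (intro integrableI_bounded) (auto intro: less_le_trans)
  then have "integrable M (\<lambda>x. 2 * (norm (f x - F n x))\<^sup>2 + 2 * (norm (F n x))\<^sup>2)"
    using F2 by simp
  then show ?thesis
  proof (rule Bochner_Integration.integrable_bound)
    show "AE x in M. norm ((norm (f x))\<^sup>2) \<le> norm (2 * (norm (f x - F n x))\<^sup>2 + 2 * (norm (F n x))\<^sup>2)"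
      using norm_add_power2_le[of "f x - F n x" "F n x" for x] by simp
  qed simp
qed

lemma L2_limit_diff_integrable: "integrable M (\<lambda>x. (norm (f x - F n x))\<^sup>2)"
proof (rule Bochner_Integration.integrable_bound)
  show "integrable M (\<lambda>x. 2 * (norm (f x))\<^sup>2 + 2 * (norm (F n x))\<^sup>2)"
    using L2_limit_square_integrable F2 by simp
  show "AE x in M. norm ((norm (f x - F n x))\<^sup>2) \<le> norm (2 * (norm (f x))\<^sup>2 + 2 * (norm (F n x))\<^sup>2)"
    using norm_add_power2_le[of "f x" "- F n x" for x] by simp
qed simp

lemma L2_limit_integral_tendsto: "(\<lambda>n. \<integral>x. (norm (f x - F n x))\<^sup>2 \<partial>M) \<longlonglongrightarrow> 0"
proof -
  have "(\<lambda>n. ennreal (\<integral>x. (norm (f x - F n x))\<^sup>2 \<partial>M)) \<longlonglongrightarrow> ennreal 0"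
    using lim by (simp add: nn_integral_eq_integral L2_limit_diff_integrable)
  then show ?thesis
    by (subst (asm) tendsto_ennreal_iff) auto
qed

end

lemma integrable_inner_square_integrable:
  fixes f g :: "'a \<Rightarrow> 'b::euclidean_space"
  assumes [measurable]: "f \<in> borel_measurable M" "g \<in> borel_measurable M"
    and "integrable M (\<lambda>x. (norm (f x))\<^sup>2)" "integrable M (\<lambda>x. (norm (g x))\<^sup>2)"
  shows "integrable M (\<lambda>x. f x \<bullet> g x)"
proof (rule Bochner_Integration.integrable_bound)
  show "integrable M (\<lambda>x. (norm (f x))\<^sup>2 + (norm (g x))\<^sup>2)"
    using assms by simp
  show "AE x in M. norm (f x \<bullet> g x) \<le> norm ((norm (f x))\<^sup>2 + (norm (g x))\<^sup>2)"
    using abs_inner_le_weighted[of 1] by (auto simp: order_trans[OF _ abs_ge_self])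
qed simp

text \<open>Continuity of the \<open>L2\<close> inner product. The integral form of Cauchy-Schwarz
  is replaced by the pointwise weighted Young inequality, with a weight that depends on
  \<open>n\<close>.\<close>

lemma L2_limit_integral_inner_tendsto:
  fixes f g :: "'a \<Rightarrow> 'b::euclidean_space"
  assumes f[measurable]: "f \<in> borel_measurable M" and F[measurable]: "\<And>n. F n \<in> borel_measurable M"
    and F2: "\<And>n. integrable M (\<lambda>x. (norm (F n x))\<^sup>2)"
    and limF: "(\<lambda>n. \<integral>\<^sup>+x. ennreal ((norm (f x - F n x))\<^sup>2) \<partial>M) \<longlonglongrightarrow> 0"
    and g[measurable]: "g \<in> borel_measurable M" and G[measurable]: "\<And>n. G n \<in> borel_measurable M"
    and G2: "\<And>n. integrable M (\<lambda>x. (norm (G n x))\<^sup>2)"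
    and limG: "(\<lambda>n. \<integral>\<^sup>+x. ennreal ((norm (g x - G n x))\<^sup>2) \<partial>M) \<longlonglongrightarrow> 0"
  shows "(\<lambda>n. \<integral>x. F n x \<bullet> G n x \<partial>M) \<longlonglongrightarrow> (\<integral>x. f x \<bullet> g x \<partial>M)"
proof -
  note f2 = L2_limit_square_integrable[OF f F F2 limF] and g2 = L2_limit_square_integrable[OF g G G2 limG]
  note df = L2_limit_diff_integrable[OF f F F2 limF] and dg = L2_limit_diff_integrable[OF g G G2 limG]
  define \<phi> where "\<phi> n = (\<integral>x. (norm (f x - F n x))\<^sup>2 \<partial>M)" for n
  define \<gamma> where "\<gamma> n = (\<integral>x. (norm (g x - G n x))\<^sup>2 \<partial>M)" for n
  define \<delta> where "\<delta> n = \<phi> n + \<gamma> n" for n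
  have nonneg: "0 \<le> \<phi> n" "0 \<le> \<gamma> n" "0 \<le> \<delta> n" for n
    by (simp_all add: \<phi>_def \<gamma>_def \<delta>_def)
  have \<delta>: "\<delta> \<longlonglongrightarrow> 0"
    unfolding \<delta>_def \<phi>_def \<gamma>_def
    using tendsto_add[OF L2_limit_integral_tendsto[OF f F F2 limF] L2_limit_integral_tendsto[OF g G G2 limG]]
    by simp
  \<comment> \<open>Both \<open>s n\<close> and \<open>\<delta> n / s n\<close> have to tend to 0,
    which the square root of \<open>\<delta> n\<close> achieves; the extra \<open>1 / Suc n\<close>
    keeps the weight positive when \<open>\<delta> n = 0\<close>.\<close>
  define s where "s n = sqrt (\<delta> n) + 1 / Suc n" for n
  have s_pos: "0 < s n" for n using nonneg by (simp add: s_def add_nonneg_pos)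
  have s: "s \<longlonglongrightarrow> 0"
    unfolding s_def using tendsto_add[OF tendsto_real_sqrt[OF \<delta>] LIMSEQ_inverse_real_of_nat]
    by (simp add: inverse_eq_divide)
  have \<delta>s: "\<delta> n / s n \<le> sqrt (\<delta> n)" for n
  proof -
    have "\<delta> n = sqrt (\<delta> n) * sqrt (\<delta> n)" using nonneg by simp
    also have "\<dots> \<le> sqrt (\<delta> n) * s n" using nonneg by (intro mult_left_mono) (auto simp: s_def)
    finally show ?thesis using s_pos by (simp add: divide_le_eq)
  qed
  define K where "K = (\<integral>x. (norm (f x))\<^sup>2 \<partial>M) + (\<integral>x. (norm (g x))\<^sup>2 \<partial>M)"
  have bound: "\<bar>(\<integral>x. F n x \<bullet> G n x \<partial>M) - (\<integral>x. f x \<bullet> g x \<partial>M)\<bar> \<le> s n * K + sqrt (\<delta> n) + \<delta> n" for n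
  proof -
    let ?h = "\<lambda>x. s n * ((norm (f x))\<^sup>2 + (norm (g x))\<^sup>2)
        + ((norm (f x - F n x))\<^sup>2 + (norm (g x - G n x))\<^sup>2) / s n
        + ((norm (f x - F n x))\<^sup>2 + (norm (g x - G n x))\<^sup>2)"
    have pw: "\<bar>F n x \<bullet> G n x - f x \<bullet> g x\<bar> \<le> ?h x" for x
    proof -
      \<comment> \<open>The first product is of second order and takes weight 1. In the other two,
        \<open>f\<close> and \<open>g\<close> have fixed norms, so the weight \<open>s n\<close>
        falls on them.\<close>
      have "F n x \<bullet> G n x - f x \<bullet> g x
        = (f x - F n x) \<bullet> (g x - G n x) - f x \<bullet> (g x - G n x) - g x \<bullet> (f x - F n x)"
        by (simp add: inner_diff_left inner_diff_right inner_commute)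
      then show ?thesis
        using abs_inner_le_weighted[of 1 "f x - F n x" "g x - G n x"]
          abs_inner_le_weighted[OF s_pos, of "f x" "g x - G n x" n]
          abs_inner_le_weighted[OF s_pos, of "g x" "f x - F n x" n]
        by (simp add: algebra_simps add_divide_distrib)
    qed
    have int1: "integrable M (\<lambda>x. F n x \<bullet> G n x)" "integrable M (\<lambda>x. f x \<bullet> g x)"
      using f2 g2 F2 G2 by (auto intro: integrable_inner_square_integrable)
    have "\<bar>(\<integral>x. F n x \<bullet> G n x \<partial>M) - (\<integral>x. f x \<bullet> g x \<partial>M)\<bar> = \<bar>\<integral>x. F n x \<bullet> G n x - f x \<bullet> g x \<partial>M\<bar>"
      using int1 by simp
    also have "\<dots> \<le> (\<integral>x. ?h x \<partial>M)"
      by (rule order_trans[OF integral_abs_bound integral_mono])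
        (use int1 f2 g2 df dg pw in auto)
    also have "\<dots> = s n * K + \<delta> n / s n + \<delta> n"
      using f2 g2 df dg by (simp add: K_def \<delta>_def \<phi>_def \<gamma>_def)
    finally show ?thesis using \<delta>s[of n] by linarith
  qed
  have "(\<lambda>n. s n * K + sqrt (\<delta> n) + \<delta> n) \<longlonglongrightarrow> 0 * K + sqrt 0 + 0"
    by (intro tendsto_add tendsto_mult tendsto_real_sqrt tendsto_const s \<delta>)
  then have "(\<lambda>n. s n * K + sqrt (\<delta> n) + \<delta> n) \<longlonglongrightarrow> 0"
    by simp
  then have "(\<lambda>n. (\<integral>x. F n x \<bullet> G n x \<partial>M) - (\<integral>x. f x \<bullet> g x \<partial>M)) \<longlonglongrightarrow> 0"
    by (rule Lim_null_comparison[rotated]) (use bound in simp)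
  then show ?thesis by (simp add: LIM_zero_iff)
qed

text \<open>Completeness of \<open>L2\<close>: a subsequence with rapidly shrinking increments
  converges almost everywhere, and Fatou's lemma carries the Cauchy bound over to its limit. The
  limit is named pointwise through the subsequence, which makes its measurability immediate.\<close>

lemma (in finite_measure) riesz_fischer:
  fixes F :: "nat \<Rightarrow> 'a \<Rightarrow> 'b::euclidean_space"
  assumes F[measurable]: "\<And>n. F n \<in> borel_measurable M"
    and Cauchy: "\<And>e. 0 < e \<Longrightarrow>
      \<exists>N. \<forall>m\<ge>N. \<forall>n\<ge>N. (\<integral>\<^sup>+x. ennreal ((norm (F m x - F n x))\<^sup>2) \<partial>M) \<le> ennreal e"
  obtains r :: "nat \<Rightarrow> nat"
  where "(\<lambda>n. \<integral>\<^sup>+x. ennreal ((norm (lim (\<lambda>i. F (r i) x) - F n x))\<^sup>2) \<partial>M) \<longlonglongrightarrow> 0"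
proof -
  have "\<forall>i. \<exists>N. \<forall>m\<ge>N. \<forall>n\<ge>N. (\<integral>\<^sup>+x. ennreal ((norm (F m x - F n x))\<^sup>2) \<partial>M) \<le> ennreal ((1/4)^i)"
    using Cauchy by simp
  then obtain N where N: "\<And>i m n. N i \<le> m \<Longrightarrow> N i \<le> n \<Longrightarrow>
      (\<integral>\<^sup>+x. ennreal ((norm (F m x - F n x))\<^sup>2) \<partial>M) \<le> ennreal ((1/4)^i)"
    by metis
  \<comment> \<open>The sum gives \<open>N i \<le> r i\<close> and
    \<open>N i \<le> r (Suc i)\<close> at once; the summand \<open>i\<close> makes \<open>r\<close>
    unbounded.\<close>
  define r where "r i = i + (\<Sum>j\<le>i. N j)" for i
  have r: "i \<le> r i" "N i \<le> r i" "N i \<le> r (Suc i)" for i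
    using member_le_sum[of i "{..i}" N] by (auto simp: r_def)
  define d where "d i x = F (r (Suc i)) x - F (r i) x" for i x
  have [measurable]: "d i \<in> borel_measurable M" for i unfolding d_def by measurable
  \<comment> \<open>With \<open>a = 2 ^ i\<close> the two terms of the bound below are
    \<open>measure M (space M) / a\<close> and \<open>1 / a\<close>.\<close>
  define K where "K = measure M (space M) + 1"
  have d: "(\<integral>\<^sup>+x. ennreal (norm (d i x)) \<partial>M) \<le> ennreal (K * (1/2)^i)" for i
  proof -
    \<comment> \<open>since the measure is finite, \<open>L1\<close> norms are controlled by \<open>2t \<le> 1 / a + a t\<^sup>2\<close>\<close>
    define a :: real where "a = 2 ^ i"
    have a: "0 < a" "(1/2)^i = 1 / a" "(1/4)^i = 1 / a\<^sup>2"
      by (simp_all add: a_def power_one_over power2_eq_square flip: power_mult_distrib)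
    have "norm (d i x) \<le> 1 / a + a * (norm (d i x))\<^sup>2" for x
    proof -
      have "0 \<le> (1 - a * norm (d i x))\<^sup>2" by simp
      then have "2 * (a * norm (d i x)) \<le> a * (1 / a + a * (norm (d i x))\<^sup>2)"
        using a(1) by (simp add: power2_eq_square algebra_simps)
      moreover have "a * norm (d i x) \<le> 2 * (a * norm (d i x))" using a(1) by simp
      ultimately have "a * norm (d i x) \<le> a * (1 / a + a * (norm (d i x))\<^sup>2)" by (rule order_trans[rotated])
      then show ?thesis using a(1) by (rule mult_left_le_imp_le)
    qed
    then have "(\<integral>\<^sup>+x. ennreal (norm (d i x)) \<partial>M)
        \<le> (\<integral>\<^sup>+x. ennreal (1 / a) + ennreal a * ennreal ((norm (d i x))\<^sup>2) \<partial>M)"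
      using a(1) by (intro nn_integral_mono) (simp flip: ennreal_mult ennreal_plus)
    also have "\<dots> = ennreal (1 / a) * emeasure M (space M)
        + ennreal a * (\<integral>\<^sup>+x. ennreal ((norm (d i x))\<^sup>2) \<partial>M)"
      by (subst nn_integral_add) (simp_all add: nn_integral_cmult)
    also have "\<dots> \<le> ennreal (1 / a) * emeasure M (space M) + ennreal a * ennreal ((1/4)^i)"
      unfolding d_def by (intro add_left_mono mult_left_mono N r) auto
    also have "\<dots> = ennreal (1 / a * measure M (space M) + a * (1/4)^i)"
      using a(1) by (simp add: emeasure_eq_measure flip: ennreal_mult ennreal_plus)
    also have "1 / a * measure M (space M) + a * (1/4)^i = K * (1/2)^i"
      unfolding a(2,3) K_def using a(1) by (simp add: power2_eq_square field_simps)
    finally show ?thesis .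
  qed
  have "(\<integral>\<^sup>+x. (\<Sum>i. ennreal (norm (d i x))) \<partial>M) = (\<Sum>i. \<integral>\<^sup>+x. ennreal (norm (d i x)) \<partial>M)"
    by (rule nn_integral_suminf) simp
  also have "\<dots> \<le> (\<Sum>i. ennreal (K * (1/2)^i))"
    by (intro suminf_le d) auto
  also have "\<dots> = ennreal (\<Sum>i. K * (1/2)^i)"
    by (rule suminf_ennreal2) (auto simp: K_def intro!: summable_mult summable_geometric)
  also have "\<dots> < \<infinity>" by simp
  finally have "AE x in M. (\<Sum>i. ennreal (norm (d i x))) \<noteq> \<infinity>"
    by (intro nn_integral_noteq_infinite) auto
  \<comment> \<open>Where the increments are absolutely summable, their partial sums telescope to
    \<open>F (r n) x - F (r 0) x\<close>.\<close>
  then have AE: "AE x in M. (\<lambda>i. F (r i) x) \<longlonglongrightarrow> lim (\<lambda>i. F (r i) x)"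
  proof eventually_elim
    case (elim x)
    then have "summable (\<lambda>i. norm (d i x))"
      by (intro summable_suminf_not_top) auto
    then have "summable (\<lambda>i. d i x)" by (rule summable_norm_cancel)
    then have "convergent (\<lambda>n. \<Sum>i<n. d i x)" by (simp add: summable_iff_convergent)
    moreover have "(\<Sum>i<n. d i x) = F (r n) x - F (r 0) x" for n
      unfolding d_def by (rule sum_lessThan_telescope)
    ultimately have "convergent (\<lambda>n. F (r n) x)" by (simp add: convergent_diff_const_right_iff)
    then show ?case by (simp add: convergent_LIMSEQ_iff)
  qed
  have "(\<integral>\<^sup>+x. ennreal ((norm (lim (\<lambda>i. F (r i) x) - F n x))\<^sup>2) \<partial>M) \<le> ennreal ((1/4)^k)" if "N k \<le> n" for k n
  proof -
    have "(\<integral>\<^sup>+x. ennreal ((norm (lim (\<lambda>i. F (r i) x) - F n x))\<^sup>2) \<partial>M)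
      = (\<integral>\<^sup>+x. liminf (\<lambda>i. ennreal ((norm (F (r i) x - F n x))\<^sup>2)) \<partial>M)"
    proof (rule nn_integral_cong_AE, use AE in eventually_elim)
      case (elim x)
      then have "(\<lambda>i. ennreal ((norm (F (r i) x - F n x))\<^sup>2)) \<longlonglongrightarrow> ennreal ((norm (lim (\<lambda>i. F (r i) x) - F n x))\<^sup>2)"
        by (intro tendsto_intros)
      from lim_imp_Liminf[OF _ this] show ?case by simp
    qed
    \<comment> \<open>Fatou's lemma. For \<open>i \<ge> N k\<close> also
      \<open>r i \<ge> N k\<close>, so the Cauchy bound applies to almost all terms of the
      sequence.\<close>
    also have "\<dots> \<le> liminf (\<lambda>i. \<integral>\<^sup>+x. ennreal ((norm (F (r i) x - F n x))\<^sup>2) \<partial>M)"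
      by (rule nn_integral_liminf) simp
    also have "\<dots> \<le> ennreal ((1/4)^k)"
    proof (rule order_trans[OF Liminf_mono])
      show "\<forall>\<^sub>F i in sequentially. (\<integral>\<^sup>+x. ennreal ((norm (F (r i) x - F n x))\<^sup>2) \<partial>M) \<le> ennreal ((1/4)^k)"
        using eventually_ge_at_top[of "N k"]
        by eventually_elim (use that r(1) in \<open>auto intro!: N intro: order_trans\<close>)
    qed (simp add: Liminf_const)
    finally show ?thesis .
  qed note tail = this
  have "(\<lambda>n. \<integral>\<^sup>+x. ennreal ((norm (lim (\<lambda>i. F (r i) x) - F n x))\<^sup>2) \<partial>M) \<longlonglongrightarrow> 0"
  proof (rule tendsto_zero_ennreal)
    fix e :: real assume "0 < e"
    then obtain k where k: "(1/4)^k < e"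
      using real_arch_pow_inv[of e "1/4"] by auto
    show "\<forall>\<^sub>F n in sequentially. (\<integral>\<^sup>+x. ennreal ((norm (lim (\<lambda>i. F (r i) x) - F n x))\<^sup>2) \<partial>M) < ennreal e"
      using eventually_ge_at_top[of "N k"]
    proof eventually_elim
      case (elim n)
      show ?case
        using tail[OF elim] k \<open>0 < e\<close> by (auto intro: le_less_trans simp: ennreal_less_iff)
    qed
  qed
  then show thesis by (rule that)
qed

section \<open>Trigonometric polynomials and the z-transform\<close>

text \<open>The index set is arbitrary so that the difference of two partial sums of the z-transform
  is again of this form.\<close>

definition trig_poly :: "(nat \<Rightarrow> real^'n) \<Rightarrow> nat set \<Rightarrow> complex \<Rightarrow> complex^'n" where
  "trig_poly q K z = (\<chi> i. \<Sum>k\<in>K. complex_of_real (q k $ i) * z powi (- int k))"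

abbreviation circle_measure :: "real measure" where
  "circle_measure \<equiv> restrict_space lborel {0..2*pi}"

lemma finite_measure_circle: "finite_measure circle_measure"
  by (rule finite_measureI) (simp add: emeasure_restrict_space space_restrict_space)

lemma integrable_circle_continuous:
  fixes f :: "real \<Rightarrow> 'b::euclidean_space"
  assumes "continuous_on UNIV f"
  shows "integrable circle_measure f"
  using borel_integrable_atLeastAtMost'[of 0 "2 * pi" f] continuous_on_subset[OF assms]
  by (simp add: integrable_restrict_space set_integrable_def)

text \<open>Orthogonality of the characters of the circle. Cosines suffice, since the real inner
  product on \<open>complex^'n\<close> is the real part of the Hermitian one.\<close>

lemma integral_cos_circle:
  "(\<integral>\<omega>. cos (of_int n * \<omega>) \<partial>circle_measure) = (if n = 0 then 2 * pi else 0)"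
proof (cases "n = 0")
  case True
  then show ?thesis
    by (simp add: measure_restrict_space space_restrict_space)
next
  case False
  have "(\<integral>\<omega>. cos (of_int n * \<omega>) \<partial>circle_measure)
      = (\<integral>\<omega>. indicator {0..2*pi} \<omega> *\<^sub>R cos (of_int n * \<omega>) \<partial>lborel)"
    by (simp add: integral_restrict_space)
  also have "\<dots> = sin (of_int n * (2 * pi)) / of_int n - sin (of_int n * 0) / of_int n"
    using False
    by (intro integral_FTC_atLeastAtMost)
      (auto intro!: derivative_eq_intros continuous_intros
        simp: has_real_derivative_iff_has_vector_derivative[symmetric])
  also have "\<dots> = 0"
    using sin_int_2pin[of n] by (simp add: mult.commute)
  finally show ?thesis using False by simp
qed

lemma inner_complex_vec: "x \<bullet> y = Re (\<Sum>i\<in>UNIV. cnj (x $ i) * y $ i)"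
  for x y :: "complex^'n"
  by (simp add: inner_vec_def inner_complex_def)

lemma norm_vector_smult_complex: "norm (c *s x) = norm c * norm x"
  for x :: "complex^'n"
  by (simp add: norm_vec_def norm_mult L2_set_right_distrib)

text \<open>On the unit circle conjugation inverts \<open>z\<close>, so the term for
  \<open>k\<close> and \<open>l\<close> has frequency \<open>k + j - l\<close>: the factor
  \<open>z powi j\<close> acts as a shift of the index.\<close>

lemma inner_trig_poly:
  fixes a b :: "nat \<Rightarrow> real^'n"
  assumes "finite K" "finite K'"
  shows "trig_poly a K (cis \<omega>) \<bullet> (cis \<omega> powi j *s trig_poly b K' (cis \<omega>))
    = (\<Sum>k\<in>K. \<Sum>l\<in>K'. (a k \<bullet> b l) * cos (of_int (int k + j - int l) * \<omega>))"
proof -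
  have cis_mult3: "cnj (cis \<omega> powi (- int k)) * (cis \<omega> powi j * cis \<omega> powi (- int l))
      = cis (of_int (int k + j - int l) * \<omega>)" for k l :: nat
    by (simp add: cis_power_int cis_mult cis_cnj algebra_simps)
  have *: "cnj (complex_of_real (a k $ i) * cis \<omega> powi (- int k))
        * (cis \<omega> powi j * (complex_of_real (b l $ i) * cis \<omega> powi (- int l)))
      = of_real (a k $ i * b l $ i) * cis (of_int (int k + j - int l) * \<omega>)" for k l i
  proof -
    have "cnj (of_real r * u) * (w * (of_real t * v)) = of_real (r * t) * (cnj u * (w * v))" for r t u v w
      by simp
    with cis_mult3 show ?thesis by (simp only:)
  qed
  have "trig_poly a K (cis \<omega>) \<bullet> (cis \<omega> powi j *s trig_poly b K' (cis \<omega>))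
    = Re (\<Sum>i\<in>UNIV. \<Sum>k\<in>K. \<Sum>l\<in>K'. of_real (a k $ i * b l $ i) * cis (of_int (int k + j - int l) * \<omega>))"
    unfolding inner_complex_vec trig_poly_def vec_lambda_beta vector_smult_component cnj_sum
      sum_distrib_left[of "cis \<omega> powi j"] sum_product * ..
  also have "\<dots> = (\<Sum>i\<in>UNIV. \<Sum>k\<in>K. \<Sum>l\<in>K'. (a k $ i * b l $ i) * cos (of_int (int k + j - int l) * \<omega>))"
    by simp
  also have "\<dots> = (\<Sum>k\<in>K. \<Sum>l\<in>K'. \<Sum>i\<in>UNIV. (a k $ i * b l $ i) * cos (of_int (int k + j - int l) * \<omega>))"
    by (subst sum.swap, rule sum.cong[OF refl], rule sum.swap)
  also have "\<dots> = (\<Sum>k\<in>K. \<Sum>l\<in>K'. (a k \<bullet> b l) * cos (of_int (int k + j - int l) * \<omega>))"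
    by (simp add: inner_vec_def sum_distrib_right)
  finally show ?thesis .
qed

lemma integrable_cos_circle: "integrable circle_measure (\<lambda>\<omega>. cos (c * \<omega>))"
  by (intro integrable_circle_continuous continuous_intros)

text \<open>By orthogonality only the pairs with \<open>l = k + j\<close> survive. The conditional
  double sum covers shifts of either sign and indices \<open>k + j\<close> that leave the
  window.\<close>

lemma integral_inner_trig_poly:
  fixes a b :: "nat \<Rightarrow> real^'n"
  assumes "finite K" "finite K'"
  shows "(\<integral>\<omega>. trig_poly a K (cis \<omega>) \<bullet> (cis \<omega> powi j *s trig_poly b K' (cis \<omega>)) \<partial>circle_measure)
    = 2 * pi * (\<Sum>k\<in>K. \<Sum>l\<in>K'. if int l = int k + j then a k \<bullet> b l else 0)"
proof -
  have "(\<integral>\<omega>. trig_poly a K (cis \<omega>) \<bullet> (cis \<omega> powi j *s trig_poly b K' (cis \<omega>)) \<partial>circle_measure)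
    = (\<Sum>k\<in>K. \<Sum>l\<in>K'. (a k \<bullet> b l) * (if int k + j - int l = 0 then 2 * pi else 0))"
    unfolding inner_trig_poly[OF assms]
    by (simp only: Bochner_Integration.integral_sum Bochner_Integration.integrable_sum
        integral_mult_right integrable_mult_right integrable_cos_circle integral_cos_circle
        Bochner_Integration.integral_mult_right_zero)
  also have "\<dots> = 2 * pi * (\<Sum>k\<in>K. \<Sum>l\<in>K'. if int l = int k + j then a k \<bullet> b l else 0)"
    unfolding sum_distrib_left by (intro sum.cong) auto
  finally show ?thesis .
qed

text \<open>The trivial factor \<open>cis \<omega> powi 0\<close> makes the norm the case
  \<open>j = 0\<close> of the correlation formula.\<close>

lemma norm2_trig_poly:
  "(norm (trig_poly q K (cis \<omega>)))\<^sup>2 = trig_poly q K (cis \<omega>) \<bullet> (cis \<omega> powi 0 *s trig_poly q K (cis \<omega>))"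
  by (simp add: power2_norm_eq_inner)

lemma integral_norm2_trig_poly:
  assumes "finite K"
  shows "(\<integral>\<omega>. (norm (trig_poly q K (cis \<omega>)))\<^sup>2 \<partial>circle_measure) = 2 * pi * (\<Sum>k\<in>K. (norm (q k))\<^sup>2)"
  unfolding norm2_trig_poly integral_inner_trig_poly[OF assms assms]
  by (simp add: assms power2_norm_eq_inner)

lemma continuous_trig_poly: "continuous_on UNIV (\<lambda>\<omega>. trig_poly q K (cis \<omega>))"
  unfolding trig_poly_def cis_power_int
  by (intro continuous_intros continuous_on_cis)

lemma measurable_trig_poly [measurable]:
  "(\<lambda>\<omega>. trig_poly q K (cis \<omega>)) \<in> borel_measurable circle_measure"
  using continuous_trig_poly
  by (intro measurable_restrict_space1) (auto intro: borel_measurable_continuous_onI)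

lemma integrable_norm2_trig_poly:
  "integrable circle_measure (\<lambda>\<omega>. (norm (trig_poly q K (cis \<omega>)))\<^sup>2)"
  by (intro integrable_circle_continuous continuous_intros continuous_trig_poly)

section \<open>Existence of z-transforms on the circle\<close>

lemma is_ztransform_iff:
  "is_ztransform q f \<longleftrightarrow> (\<lambda>\<omega>. f (cis \<omega>)) \<in> borel_measurable circle_measure \<and>
     (\<lambda>N. \<integral>\<^sup>+\<omega>. ennreal ((norm (f (cis \<omega>) - trig_poly q {..<N} (cis \<omega>)))\<^sup>2) \<partial>circle_measure)
       \<longlonglongrightarrow> 0"
  unfolding is_ztransform_def set_borel_measurable_def trig_poly_def
  by (simp add: borel_measurable_restrict_space_iff nn_integral_restrict_space)

text \<open>By Parseval the squared distance of two partial sums is \<open>2 * pi\<close> times a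
  section of the convergent series of squares, so the partial sums are Cauchy. Existence of a limit
  is what makes the choice in \<open>ztransform\<close> meaningful.\<close>

lemma is_ztransform_ztransform:
  assumes "q \<in> ell2"
  shows "is_ztransform q (ztransform q)"
proof -
  interpret finite_measure circle_measure by (rule finite_measure_circle)
  define F where "F n \<omega> = trig_poly q {..<n} (cis \<omega>)" for n \<omega>
  have [measurable]: "F n \<in> borel_measurable circle_measure" for n
    unfolding F_def by measurable
  have diff: "(\<integral>\<^sup>+\<omega>. ennreal ((norm (F m \<omega> - F n \<omega>))\<^sup>2) \<partial>circle_measure)
      = ennreal (2 * pi * (\<Sum>k=n..<m. (norm (q k))\<^sup>2))" if "n \<le> m" for m n
  proof -
    have "F m \<omega> - F n \<omega> = trig_poly q {n..<m} (cis \<omega>)" for \<omega>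
      using sum_diff_nat_ivl[of 0 n m "\<lambda>k. complex_of_real (q k $ i) * cis \<omega> powi (- int k)" for i] that
      by (simp add: F_def trig_poly_def vec_eq_iff atLeast0LessThan)
    then show ?thesis
      by (simp add: nn_integral_eq_integral integrable_norm2_trig_poly integral_norm2_trig_poly)
  qed
  have Cauchy: "\<exists>N. \<forall>m\<ge>N. \<forall>n\<ge>N. (\<integral>\<^sup>+\<omega>. ennreal ((norm (F m \<omega> - F n \<omega>))\<^sup>2) \<partial>circle_measure) \<le> ennreal e"
    if "0 < e" for e
  proof -
    have "summable (\<lambda>k. (norm (q k))\<^sup>2)" using assms by (simp add: ell2_def)
    then obtain N where N: "\<And>m n. N \<le> m \<Longrightarrow> norm (\<Sum>k=m..<n. (norm (q k))\<^sup>2) < e / (2 * pi)"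
      using \<open>0 < e\<close> unfolding summable_Cauchy by (meson divide_pos_pos pi_gt_zero zero_less_mult_iff zero_less_numeral)
    have *: "(\<integral>\<^sup>+\<omega>. ennreal ((norm (F m \<omega> - F n \<omega>))\<^sup>2) \<partial>circle_measure) \<le> ennreal e"
      if "N \<le> n" "n \<le> m" for m n
    proof -
      have "2 * pi * (\<Sum>k=n..<m. (norm (q k))\<^sup>2) \<le> e"
        using N[OF that(1), of m] by (simp add: sum_nonneg field_simps)
      then show ?thesis unfolding diff[OF that(2)] by (rule ennreal_leI)
    qed
    have "(\<integral>\<^sup>+\<omega>. ennreal ((norm (F m \<omega> - F n \<omega>))\<^sup>2) \<partial>circle_measure) \<le> ennreal e"
      if "N \<le> m" "N \<le> n" for m n
      using *[of n m] *[of m n] that by (cases "n \<le> m") (auto simp: norm_minus_commute)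
    then show ?thesis by blast
  qed
  obtain r where r: "(\<lambda>n. \<integral>\<^sup>+\<omega>. ennreal ((norm (lim (\<lambda>i. F (r i) \<omega>) - F n \<omega>))\<^sup>2) \<partial>circle_measure) \<longlonglongrightarrow> 0"
    using riesz_fischer[OF _ Cauchy] by (metis \<open>\<And>n. F n \<in> borel_measurable circle_measure\<close>)
  have "(\<lambda>\<omega>. lim (\<lambda>i. F (r i) \<omega>)) \<in> borel_measurable circle_measure"
    by measurable
  \<comment> \<open>A z-transform is a function of \<open>z\<close>, not of \<open>\<omega>\<close>.
    The pointwise limit depends on \<open>\<omega>\<close> through \<open>cis \<omega>\<close>
    alone, hence can be written in \<open>z\<close>.\<close>
  with r have "is_ztransform q (\<lambda>z. lim (\<lambda>i. trig_poly q {..<r i} z))"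
    unfolding is_ztransform_iff F_def by blast
  then show ?thesis
    unfolding ztransform_def by (rule someI[where P = "is_ztransform q"])
qed

section \<open>Monotone gradients\<close>

text \<open>The gradient is the Riesz representative of the derivative, obtained as
  \<open>adjoint D 1\<close>; its uniqueness justifies the definite description in
  \<open>grad\<close>.\<close>

lemma GDERIV_grad:
  fixes H :: "real^'n \<Rightarrow> real"
  assumes "H differentiable (at x)"
  shows "GDERIV H x :> grad H x"
proof -
  obtain D where D: "(H has_derivative D) (at x)"
    using assms unfolding differentiable_def by blast
  then interpret D: bounded_linear D
    by (rule has_derivative_bounded_linear)
  define g where "g = adjoint D 1"
  have "D = (\<lambda>h. h \<bullet> g)"
    using adjoint_works[OF D.linear, of _ 1] by (simp add: g_def fun_eq_iff)
  then have ex: "GDERIV H x :> g"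
    using D by (simp add: gderiv_def)
  have "g' = g" if "GDERIV H x :> g'" for g'
  proof -
    have "(\<lambda>h. h \<bullet> g') = (\<lambda>h. h \<bullet> g)"
      using that ex unfolding gderiv_def by (rule has_derivative_unique)
    then show ?thesis by (metis vector_eq_ldot)
  qed
  then show ?thesis
    unfolding grad_def by (metis ex theI)
qed

text \<open>The mean value theorem on the segment from \<open>y\<close> to \<open>x\<close> yields
  an intermediate gradient; monotonicity, divided by the parameter \<open>t > 0\<close>, compares it
  with \<open>G y\<close>.\<close>

lemma monotone_gradient_tangent_le:
  fixes f :: "'a::real_inner \<Rightarrow> real"
  assumes G: "\<And>x. GDERIV f x :> G x"
    and mono: "\<And>x y. 0 \<le> (G x - G y) \<bullet> (x - y)"
  shows "f y + G y \<bullet> (x - y) \<le> f x"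
proof -
  define \<phi> where "\<phi> t = f (y + t *\<^sub>R (x - y))" for t :: real
  have \<phi>: "(\<phi> has_real_derivative G (y + t *\<^sub>R (x - y)) \<bullet> (x - y)) (at t)" for t
  proof -
    have "((\<lambda>t. y + t *\<^sub>R (x - y)) has_derivative (\<lambda>s. s *\<^sub>R (x - y))) (at t)"
      by (auto intro!: derivative_eq_intros)
    from has_derivative_compose[OF this G[unfolded gderiv_def]] show ?thesis
      by (simp add: \<phi>_def[abs_def] has_field_derivative_def mult_commute_abs inner_commute)
  qed
  obtain t where t: "0 < t" "\<phi> 1 - \<phi> 0 = (1 - 0) * (G (y + t *\<^sub>R (x - y)) \<bullet> (x - y))"
    using MVT2[of 0 1 \<phi>, OF zero_less_one \<phi>] by metis
  have "0 \<le> (G (y + t *\<^sub>R (x - y)) - G y) \<bullet> (t *\<^sub>R (x - y))"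
    using mono[of "y + t *\<^sub>R (x - y)" y] by simp
  then have "0 \<le> (G (y + t *\<^sub>R (x - y)) - G y) \<bullet> (x - y)"
    using t(1) by (simp add: zero_le_mult_iff)
  with t(2) show ?thesis
    by (simp add: \<phi>_def inner_diff_left)
qed

lemma GDERIV_norm_power2: "GDERIV (\<lambda>x. c / 2 * (norm x)\<^sup>2) x :> c *\<^sub>R x"
  unfolding gderiv_def power2_norm_eq_inner
  by (auto intro!: derivative_eq_intros simp: inner_commute algebra_simps)

text \<open>A gradient step cannot go below the tangent, so its guaranteed decrease bounds the
  tangent gap from below. Multiplying through by \<open>K\<close> keeps the case
  \<open>K = 0\<close>, which arises for \<open>L = m\<close>.\<close>

lemma smooth_monotone_gradient_ineq:
  fixes f :: "'a::real_inner \<Rightarrow> real"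
  assumes G: "\<And>x. GDERIV f x :> G x"
    and mono: "\<And>x y. 0 \<le> (G x - G y) \<bullet> (x - y)"
    and upper: "\<And>x y. (G x - G y) \<bullet> (x - y) \<le> K * (norm (x - y))\<^sup>2"
    and "0 \<le> K"
  shows "(norm (G x - G y))\<^sup>2 / 2 \<le> K * (f x - f y - G y \<bullet> (x - y))"
proof -
  define d where "d = G x - G y"
  define e where "e = f x - f y - G y \<bullet> (x - y)"
  have key: "t * (norm d)\<^sup>2 - K / 2 * t\<^sup>2 * (norm d)\<^sup>2 \<le> e" for t
  proof -
    \<comment> \<open>a gradient step of length \<open>t\<close> for the convex function \<open>f - (f y + G y \<bullet> (\<cdot> - y)) \<ge> 0\<close>\<close>
    define z where "z = x - t *\<^sub>R d"
    have lower: "f y + G y \<bullet> (z - y) \<le> f z"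
      using G mono by (rule monotone_gradient_tangent_le)
    \<comment> \<open>The descent lemma: by \<open>upper\<close> the function
      \<open>K / 2 * (norm x)\<^sup>2 - f x\<close> has a monotone gradient, and its tangent
      inequality bounds \<open>f z\<close> from above.\<close>
    have "K / 2 * (norm x)\<^sup>2 - f x + (K *\<^sub>R x - G x) \<bullet> (z - x) \<le> K / 2 * (norm z)\<^sup>2 - f z"
    proof (rule monotone_gradient_tangent_le[where f = "\<lambda>x. K / 2 * (norm x)\<^sup>2 - f x" and G = "\<lambda>x. K *\<^sub>R x - G x"])
      show "GDERIV (\<lambda>x. K / 2 * (norm x)\<^sup>2 - f x) x :> (K *\<^sub>R x - G x)" for x
        by (rule GDERIV_diff GDERIV_norm_power2 G)+
      show "0 \<le> ((K *\<^sub>R x - G x) - (K *\<^sub>R y - G y)) \<bullet> (x - y)" for x y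
        using upper[of x y]
        by (simp add: power2_norm_eq_inner algebra_simps)
    qed
    then have "f z \<le> f x + G x \<bullet> (z - x) + K / 2 * (norm (z - x))\<^sup>2"
      by (simp add: power2_norm_eq_inner inner_diff_left inner_diff_right inner_commute algebra_simps)
    moreover have "(norm (z - x))\<^sup>2 = t\<^sup>2 * (norm d)\<^sup>2"
      by (simp add: z_def power_mult_distrib)
    moreover have "G x \<bullet> (z - x) - G y \<bullet> (z - y) = - t * (norm d)\<^sup>2 - G y \<bullet> (x - y)"
      unfolding z_def power2_norm_eq_inner
      by (simp add: d_def algebra_simps)
    ultimately show ?thesis
      using lower by (simp add: e_def mult.assoc)
  qed
  have "(norm d)\<^sup>2 / 2 \<le> K * e"
  proof (cases "K = 0")
    case True
    \<comment> \<open>For \<open>K = 0\<close> the bound \<open>key\<close> is linear in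
      \<open>t\<close>; the chosen step would give \<open>e + 1 \<le> e\<close>.\<close>
    have "d = 0"
    proof (rule ccontr)
      assume "d \<noteq> 0"
      then show False using key[of "(e + 1) / (norm d)\<^sup>2"] True by simp
    qed
    with True show ?thesis by simp
  next
    case False
    \<comment> \<open>The step length \<open>1 / K\<close> maximizes
      \<open>t - K / 2 * t\<^sup>2\<close>.\<close>
    have "K * ((norm d)\<^sup>2 / (2 * K)) \<le> K * e"
    proof (rule mult_left_mono[OF _ \<open>0 \<le> K\<close>])
      show "(norm d)\<^sup>2 / (2 * K) \<le> e"
        using key[of "1 / K"] False by (simp add: power2_eq_square field_simps)
    qed
    with False show ?thesis by simp
  qed
  then show ?thesis by (simp add: d_def e_def)
qed

text \<open>Subtracting \<open>m / 2 * (norm x)\<^sup>2\<close> leaves a monotone gradient. The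
  resulting quadratic growth gives both existence and uniqueness of the minimizer.\<close>

lemma strongly_monotone_gradient_lower_bound:
  fixes f :: "'a::real_inner \<Rightarrow> real"
  assumes G: "\<And>x. GDERIV f x :> G x"
    and mono: "\<And>x y. m * (norm (x - y))\<^sup>2 \<le> (G x - G y) \<bullet> (x - y)"
  shows "f y + G y \<bullet> (x - y) + m / 2 * (norm (x - y))\<^sup>2 \<le> f x"
proof -
  have "f y - m / 2 * (norm y)\<^sup>2 + (G y - m *\<^sub>R y) \<bullet> (x - y) \<le> f x - m / 2 * (norm x)\<^sup>2"
  proof (rule monotone_gradient_tangent_le[where f = "\<lambda>x. f x - m / 2 * (norm x)\<^sup>2" and G = "\<lambda>x. G x - m *\<^sub>R x"])
    show "GDERIV (\<lambda>x. f x - m / 2 * (norm x)\<^sup>2) x :> (G x - m *\<^sub>R x)" for x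
      by (rule GDERIV_diff GDERIV_norm_power2 G)+
    show "0 \<le> ((G x - m *\<^sub>R x) - (G y - m *\<^sub>R y)) \<bullet> (x - y)" for x y
      using mono[of x y]
      by (simp add: power2_norm_eq_inner algebra_simps)
  qed
  then show ?thesis
    by (simp add: power2_norm_eq_inner inner_diff_left inner_diff_right inner_commute algebra_simps)
qed

text \<open>\<open>minimizer\<close> is a definite description, so a unique minimizer has to be
  exhibited first: compactness of a ball provides a candidate, growth outside the ball makes it
  global, and quadratic growth around it makes it unique.\<close>

lemma grad_minimizer:
  fixes H :: "real^'n \<Rightarrow> real"
  assumes G: "\<And>x. GDERIV H x :> G x"
    and mono: "\<And>x y. m * (norm (x - y))\<^sup>2 \<le> (G x - G y) \<bullet> (x - y)"
    and "0 < m"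
  shows "G (minimizer H) = 0"
proof -
  note lower = strongly_monotone_gradient_lower_bound[OF G mono]
  \<comment> \<open>Beyond this radius the quadratic term \<open>m / 2 * (norm x)\<^sup>2\<close>
    dominates the linear term \<open>norm (G 0) * norm x\<close>.\<close>
  define R where "R = 2 * norm (G 0) / m"
  have cont: "continuous_on S H" for S
    using G unfolding gderiv_def
    by (meson continuous_at_imp_continuous_on has_derivative_continuous)
  have "0 \<le> R" using \<open>0 < m\<close> by (simp add: R_def)
  then obtain z where z: "\<And>x. x \<in> cball 0 R \<Longrightarrow> H z \<le> H x"
    using continuous_attains_inf[OF compact_cball _ cont, of 0 R]
    by (metis cball_eq_empty not_less)
  have zmin: "H z \<le> H x" for x
  proof (cases "x \<in> cball 0 R")
    case False
    then have "R < norm x" by simp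
    then have "0 \<le> norm x * (m / 2 * norm x - norm (G 0))"
      using \<open>0 < m\<close> by (intro mult_nonneg_nonneg) (auto simp: R_def field_simps)
    moreover have "- (norm (G 0) * norm x) \<le> G 0 \<bullet> x"
      using Cauchy_Schwarz_ineq2[of "G 0" x] by linarith
    ultimately have "H 0 \<le> H x"
      using lower[of 0 x] by (simp add: power2_eq_square algebra_simps)
    moreover have "H z \<le> H 0" using z \<open>0 \<le> R\<close> by simp
    ultimately show ?thesis by simp
  qed (rule z)
  have "(\<lambda>h. h \<bullet> G z) = (\<lambda>h. 0)"
    using differential_zero_maxmin[of z UNIV H "\<lambda>h. h \<bullet> G z"] G[of z] zmin
    by (auto simp: gderiv_def)
  then have Gz: "G z = 0" by (metis inner_eq_zero_iff)
  have "minimizer H = z"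
    unfolding minimizer_def
  proof (rule the_equality)
    show "is_arg_min H (\<lambda>_. True) z"
      by (simp add: is_arg_min_def zmin leD)
    fix y assume "is_arg_min H (\<lambda>_. True) y"
    then have "H y \<le> H z" by (simp add: is_arg_min_linorder)
    then have "m / 2 * (norm (y - z))\<^sup>2 \<le> 0"
      using lower[of z y] Gz by simp
    then show "y = z"
      using \<open>0 < m\<close> by (simp add: mult_le_0_iff)
  qed
  then show ?thesis using Gz by simp
qed

section \<open>Weighted sums of correlations over shifts\<close>

lemma sum_at_most_one_le:
  fixes a :: real
  assumes "0 \<le> a" "finite A" "inj_on f A"
  shows "(\<Sum>l\<in>A. if f l = t then a else 0) \<le> a"
proof (cases "t \<in> f ` A")
  case True
  then obtain l0 where l0: "l0 \<in> A" "f l0 = t" by blast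
  have "(\<Sum>l\<in>A. if f l = t then a else 0) = (\<Sum>l\<in>A. if l = l0 then a else 0)"
    using l0 assms(3) by (intro sum.cong) (auto simp: inj_on_def)
  with l0 assms show ?thesis by simp
next
  case False
  then have "(\<Sum>l\<in>A. if f l = t then a else 0) = 0"
    by (intro sum.neutral) auto
  with assms show ?thesis by simp
qed

text \<open>Each correlation is at most \<open>\<rho> powi (- j) * A + \<rho> powi j * B\<close>,
  and a nonpositive \<open>c j\<close> reverses this. At \<open>j = 0\<close> the coefficient may be
  positive, so an upper bound would point the wrong way; there \<open>diag\<close> supplies
  equality. Weighting the two row sums by \<open>A\<close> and \<open>B\<close> concludes.\<close>

lemma weighted_shift_sum_nonneg:
  fixes x :: "nat \<Rightarrow> nat \<Rightarrow> real" and \<alpha> \<beta> :: "nat \<Rightarrow> real" and c :: "int \<Rightarrow> real"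
  assumes "0 < \<rho>" and nonneg: "\<And>k. 0 \<le> \<alpha> k" "\<And>k. 0 \<le> \<beta> k"
    and le: "\<And>k l. x k l \<le> \<rho> powi (int k - int l) * \<alpha> k + \<rho> powi (int l - int k) * \<beta> l"
    and diag: "\<And>k. x k k = \<alpha> k + \<beta> k"
    and c: "\<And>j. j \<in> J \<Longrightarrow> j \<noteq> 0 \<Longrightarrow> c j \<le> 0"
    and sums: "0 \<le> (\<Sum>j\<in>J. \<rho> powi (- j) * c j)" "0 \<le> (\<Sum>j\<in>J. \<rho> powi j * c j)"
  shows "0 \<le> (\<Sum>j\<in>J. c j * (\<Sum>k<N. \<Sum>l<N. if int l = int k + j then x k l else 0))"
proof -
  define T where "T j = (\<Sum>k<N. \<Sum>l<N. if int l = int k + j then x k l else 0)" for j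
  define A where "A = (\<Sum>k<N. \<alpha> k)"
  define B where "B = (\<Sum>k<N. \<beta> k)"
  have AB: "0 \<le> A" "0 \<le> B" by (simp_all add: A_def B_def nonneg sum_nonneg)
  have T_le: "T j \<le> \<rho> powi (- j) * A + \<rho> powi j * B" for j
  proof -
    \<comment> \<open>On the shifted diagonal the exponents \<open>k - l\<close> and
      \<open>l - k\<close> are \<open>- j\<close> and \<open>j\<close>. The condition of the second
      term is solved for \<open>k\<close>, so that it can be summed over \<open>k\<close> with
      \<open>l\<close> fixed.\<close>
    have "T j \<le> (\<Sum>k<N. \<Sum>l<N. (if int l = int k + j then \<rho> powi (- j) * \<alpha> k else 0)
                            + (if int k = int l - j then \<rho> powi j * \<beta> l else 0))"
      unfolding T_def
    proof (intro sum_mono)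
      fix k l
      show "(if int l = int k + j then x k l else 0)
        \<le> (if int l = int k + j then \<rho> powi (- j) * \<alpha> k else 0)
          + (if int k = int l - j then \<rho> powi j * \<beta> l else 0)"
        using le[of k l] by auto
    qed
    also have "\<dots> = (\<Sum>k<N. \<Sum>l<N. if int l = int k + j then \<rho> powi (- j) * \<alpha> k else 0)
                 + (\<Sum>l<N. \<Sum>k<N. if int k = int l - j then \<rho> powi j * \<beta> l else 0)"
      by (subst (3) sum.swap) (simp add: sum.distrib)
    \<comment> \<open>Each inner sum has at most one nonzero entry, and none if the shifted index
      leaves the window; nonnegativity of \<open>\<alpha>\<close> and \<open>\<beta>\<close> turns
      this loss into an upper bound.\<close>
    also have "\<dots> \<le> (\<Sum>k<N. \<rho> powi (- j) * \<alpha> k) + (\<Sum>l<N. \<rho> powi j * \<beta> l)"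
      using \<open>0 < \<rho>\<close> nonneg by (intro add_mono sum_mono sum_at_most_one_le) auto
    finally show ?thesis by (simp add: A_def B_def sum_distrib_left)
  qed
  have T0: "T 0 = A + B"
    by (simp add: T_def A_def B_def diag sum.distrib)
  have "0 \<le> A * (\<Sum>j\<in>J. \<rho> powi (- j) * c j) + B * (\<Sum>j\<in>J. \<rho> powi j * c j)"
    using AB sums by simp
  also have "\<dots> = (\<Sum>j\<in>J. c j * (\<rho> powi (- j) * A + \<rho> powi j * B))"
    by (simp add: sum_distrib_left sum.distrib algebra_simps)
  also have "\<dots> \<le> (\<Sum>j\<in>J. c j * T j)"
  proof (rule sum_mono)
    fix j assume "j \<in> J"
    then show "c j * (\<rho> powi (- j) * A + \<rho> powi j * B) \<le> c j * T j"
      using T_le[of j] T0 c[of j] by (cases "j = 0") (auto intro: mult_left_mono_neg)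
  qed
  finally show ?thesis by (simp add: T_def)
qed

section \<open>The quadratic form of a multiplier\<close>

lemma block_vec_nth [simp]:
  "block_vec x y $ Inl i = x $ i" "block_vec x y $ Inr j = y $ j"
  by (simp_all add: block_vec_def)

lemma sum_UNIV_Plus:
  "(\<Sum>i\<in>(UNIV :: ('a::finite + 'b::finite) set). f i) = (\<Sum>i\<in>UNIV. f (Inl i)) + (\<Sum>j\<in>UNIV. f (Inr j))"
  using sum.Plus[of UNIV UNIV f] by (simp add: comp_def)

lemma block_mat_mult_block_vec:
  "block_mat A B C D *v block_vec x y = block_vec (A *v x + B *v y) (C *v x + D *v y)"
proof -
  have "(block_mat A B C D *v block_vec x y) $ i = block_vec (A *v x + B *v y) (C *v x + D *v y) $ i" for i
    by (cases i) (simp_all add: block_mat_def matrix_vector_mult_def sum_UNIV_Plus)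
  then show ?thesis by (simp add: vec_eq_iff)
qed

text \<open>Since \<open>W\<close> is real, its plain transpose acts as the adjoint.\<close>

lemma quad_form_transpose_conjugate:
  fixes W :: "complex^'a^'b"
  assumes "\<And>i j. cnj (W $ i $ j) = W $ i $ j"
  shows "quad_form (transpose W ** B ** W) v = quad_form B (W *v v)"
proof -
  have transpose_nth: "(transpose W *v x) $ i = (\<Sum>k\<in>UNIV. W $ k $ i * x $ k)" for x i
    by (simp add: matrix_vector_mult_def transpose_def)
  have "quad_form (transpose W ** B ** W) v = (\<Sum>i\<in>UNIV. cnj (v $ i) * (transpose W *v (B *v (W *v v))) $ i)"
    by (simp add: quad_form_def flip: matrix_vector_mul_assoc)
  also have "\<dots> = (\<Sum>i\<in>UNIV. \<Sum>k\<in>UNIV. cnj (W $ k $ i * v $ i) * (B *v (W *v v)) $ k)"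
    unfolding transpose_nth by (simp add: sum_distrib_left assms mult_ac)
  also have "\<dots> = (\<Sum>k\<in>UNIV. cnj ((W *v v) $ k) * (B *v (W *v v)) $ k)"
    by (subst sum.swap) (simp add: matrix_vector_mult_def[of W v] sum_distrib_right)
  finally show ?thesis by (simp add: quad_form_def)
qed

lemma E_fun_mult_vec:
  assumes "\<And>j. j \<in> {- int lm..int lp} \<Longrightarrow> M j = mat (c j)"
  shows "E_fun lp lm M z *v x = (\<Sum>j\<in>{- int lm..int lp}. complex_of_real (c j) * z powi j) *s x"
    and "ctranspose (E_fun lp lm M z) *v x = cnj (\<Sum>j\<in>{- int lm..int lp}. complex_of_real (c j) * z powi j) *s x"
proof -
  let ?e = "\<Sum>j\<in>{- int lm..int lp}. complex_of_real (c j) * z powi j"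
  have "E_fun lp lm M z = (\<chi> a b. \<Sum>j\<in>{- int lm..int lp}. complex_of_real (mat (c j) $ a $ b) * z powi j)"
    by (simp add: E_fun_def assms)
  also have "\<dots> = mat ?e"
    by (simp add: vec_eq_iff mat_def)
  finally have E: "E_fun lp lm M z = mat ?e" .
  have mat: "mat e *v y = e *s y" for e :: complex and y :: "complex^'n"
    by (simp add: vec_eq_iff matrix_vector_mult_def mat_def if_distrib if_distribR cong: if_cong)
  have ctr: "ctranspose (mat e) = (mat (cnj e) :: complex^'n^'n)" for e
    by (auto simp: vec_eq_iff ctranspose_def mat_def)
  show "E_fun lp lm M z *v x = ?e *s x" "ctranspose (E_fun lp lm M z) *v x = cnj ?e *s x"
    unfolding E ctr by (rule mat)+
qed

text \<open>\<open>W_mat\<close> maps the pair to \<open>((L - m) *\<^sub>R x - y, y)\<close>. As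
  all blocks of \<open>M\<close> are multiples of the identity, the off-diagonal blocks act as
  conjugate scalars, contributing \<open>s\<close> and \<open>cnj s\<close>. The value is thus real,
  in the form that Parseval turns into correlations.\<close>

lemma quad_form_multiplier:
  fixes x y :: "complex^'n"
  assumes "\<And>j. j \<in> {- int lm..int lp} \<Longrightarrow> M j = mat (c j)"
  shows "quad_form (transpose (W_mat m L) **
      block_mat 0 (ctranspose (E_fun lp lm M z)) (E_fun lp lm M z) 0 ** W_mat m L) (block_vec x y)
    = of_real (2 * (\<Sum>j\<in>{- int lm..int lp}. c j * (y \<bullet> (z powi j *s ((L - m) *\<^sub>R x - y)))))"
proof -
  define e where "e = (\<Sum>j\<in>{- int lm..int lp}. complex_of_real (c j) * z powi j)"
  define a where "a = (L - m) *\<^sub>R x - y"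
  define s where "s = (\<Sum>i\<in>UNIV. cnj (y $ i) * (e * a $ i))"
  have W: "W_mat m L *v block_vec x y = block_vec a y"
  proof -
    have "mat (complex_of_real (L - m)) *v x = (L - m) *\<^sub>R x"
      by (simp add: vec_eq_iff matrix_vector_mult_def mat_def if_distrib if_distribR scaleR_conv_of_real[where 'a = complex] cong: if_cong)
    moreover have "(- mat 1) *v y = - y"
      by (simp add: vec_eq_iff matrix_vector_mult_def mat_def if_distrib if_distribR cong: if_cong)
    ultimately show ?thesis
      by (simp add: W_mat_def block_mat_mult_block_vec a_def)
  qed
  have E: "E_fun lp lm M z *v w = e *s w" "ctranspose (E_fun lp lm M z) *v w = cnj e *s w" for w
    unfolding e_def by (rule E_fun_mult_vec, erule assms)+
  have "cnj (W_mat m L $ i $ j) = (W_mat m L :: complex^('n + 'n)^('n + 'n)) $ i $ j" for i j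
    by (cases i; cases j) (auto simp: W_mat_def block_mat_def mat_def)
  then have "quad_form (transpose (W_mat m L) **
      block_mat 0 (ctranspose (E_fun lp lm M z)) (E_fun lp lm M z) 0 ** W_mat m L) (block_vec x y)
    = quad_form (block_mat 0 (ctranspose (E_fun lp lm M z)) (E_fun lp lm M z) 0) (block_vec a y)"
    by (simp add: quad_form_transpose_conjugate W)
  also have "\<dots> = (\<Sum>i\<in>UNIV. cnj (a $ i) * (cnj e * y $ i)) + s"
    by (simp add: quad_form_def block_mat_mult_block_vec E sum_UNIV_Plus s_def)
  also have "\<dots> = cnj s + s"
    by (simp add: s_def mult_ac)
  also have "\<dots> = of_real (2 * Re s)"
    by (simp add: complex_eq_iff)
  also have "Re s = y \<bullet> (e *s a)"
    by (simp add: s_def inner_complex_vec)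
  also have "e *s a = (\<Sum>j\<in>{- int lm..int lp}. c j *\<^sub>R (z powi j *s a))"
    by (simp add: vec_eq_iff e_def sum_distrib_right scaleR_conv_of_real[where 'a = complex] mult.assoc)
  also have "y \<bullet> \<dots> = (\<Sum>j\<in>{- int lm..int lp}. c j * (y \<bullet> (z powi j *s a)))"
    by (simp add: inner_sum_right)
  finally show ?thesis by (simp add: a_def)
qed

text \<open>For multiples of the identity, each elementwise row-sum or column-sum condition
  collapses to one scalar inequality.\<close>

lemma M_set_cases:
  fixes M :: "int \<Rightarrow> real^'n^'n"
  assumes "M \<in> M_set \<rho> lp lm"
  obtains c where "\<And>j. j \<in> {- int lm..int lp} \<Longrightarrow> M j = mat (c j)"
    and "\<And>j. j \<in> {- int lm..int lp} \<Longrightarrow> j \<noteq> 0 \<Longrightarrow> c j \<le> 0"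
    and "0 \<le> (\<Sum>j\<in>{- int lm..int lp}. \<rho> powi (- j) * c j)"
    and "0 \<le> (\<Sum>j\<in>{- int lm..int lp}. \<rho> powi j * c j)"
proof -
  let ?J = "{- int lm..int lp}"
  have M: "(\<exists>c. (\<forall>i\<in>?J. M i = mat (c i)) \<and> (\<forall>i\<in>?J. i \<noteq> 0 \<longrightarrow> c i \<le> 0)) \<and>
      0 \<le> (\<Sum>j\<in>?J. \<rho> powi (- j) *\<^sub>R M j) *v 1 \<and> 0 \<le> 1 v* (\<Sum>j\<in>?J. \<rho> powi j *\<^sub>R M j)"
    using assms by (simp only: M_set_def mem_Collect_eq)
  obtain c where c: "\<And>j. j \<in> ?J \<Longrightarrow> M j = mat (c j)" "\<And>j. j \<in> ?J \<Longrightarrow> j \<noteq> 0 \<Longrightarrow> c j \<le> 0"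
    using conjunct1[OF M] by metis
  have sum: "(\<Sum>j\<in>?J. w j *\<^sub>R M j) = mat (\<Sum>j\<in>?J. w j * c j)" for w :: "int \<Rightarrow> real"
    by (simp add: vec_eq_iff mat_def c(1))
  have "mat s *v (1 :: real^'n) = (\<chi> i. s)" "(1 :: real^'n) v* mat s = (\<chi> i. s)" for s :: real
    by (simp_all add: vec_eq_iff matrix_vector_mult_def vector_matrix_mult_def mat_def one_vec_def
        if_distrib if_distribR cong: if_cong)
  with conjunct2[OF M] have "0 \<le> (\<Sum>j\<in>?J. \<rho> powi (- j) * c j)" "0 \<le> (\<Sum>j\<in>?J. \<rho> powi j * c j)"
    by (simp_all add: sum less_eq_vec_def)
  with c show thesis by (rule that)
qed

section \<open>The quadratic constraint\<close>

text \<open>Linearity is stated for the relation, because transforms picked by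
  \<open>ztransform\<close> are determined only up to null sets.\<close>

lemma is_ztransform_scaleR_diff:
  assumes "is_ztransform a f" "is_ztransform b g"
  shows "is_ztransform (\<lambda>k. c *\<^sub>R a k - b k) (\<lambda>z. c *\<^sub>R f z - g z)"
proof -
  have [measurable]: "(\<lambda>\<omega>. f (cis \<omega>)) \<in> borel_measurable circle_measure"
      "(\<lambda>\<omega>. g (cis \<omega>)) \<in> borel_measurable circle_measure"
    using assms by (simp_all add: is_ztransform_iff)
  let ?I = "\<lambda>a f N. \<integral>\<^sup>+\<omega>. ennreal ((norm (f (cis \<omega>) - trig_poly a {..<N} (cis \<omega>)))\<^sup>2) \<partial>circle_measure"
  have le: "?I (\<lambda>k. c *\<^sub>R a k - b k) (\<lambda>z. c *\<^sub>R f z - g z) N \<le> ennreal (2 * c\<^sup>2) * ?I a f N + 2 * ?I b g N" for N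
  proof -
    have pw: "(norm (c *\<^sub>R f z - g z - trig_poly (\<lambda>k. c *\<^sub>R a k - b k) {..<N} z))\<^sup>2
       \<le> 2 * c\<^sup>2 * (norm (f z - trig_poly a {..<N} z))\<^sup>2 + 2 * (norm (g z - trig_poly b {..<N} z))\<^sup>2" for z
    proof -
      have eq: "c *\<^sub>R f z - g z - trig_poly (\<lambda>k. c *\<^sub>R a k - b k) {..<N} z
          = c *\<^sub>R (f z - trig_poly a {..<N} z) + - (g z - trig_poly b {..<N} z)"
        by (simp add: vec_eq_iff trig_poly_def algebra_simps sum_subtractf scaleR_conv_of_real[where 'a = complex] sum_distrib_left)
      show ?thesis
        unfolding eq using norm_add_power2_le[of "c *\<^sub>R (f z - trig_poly a {..<N} z)" "- (g z - trig_poly b {..<N} z)"]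
        by (simp add: power_mult_distrib norm_minus_commute)
    qed
    have "?I (\<lambda>k. c *\<^sub>R a k - b k) (\<lambda>z. c *\<^sub>R f z - g z) N
      \<le> (\<integral>\<^sup>+\<omega>. ennreal (2 * c\<^sup>2) * ennreal ((norm (f (cis \<omega>) - trig_poly a {..<N} (cis \<omega>)))\<^sup>2)
          + ennreal 2 * ennreal ((norm (g (cis \<omega>) - trig_poly b {..<N} (cis \<omega>)))\<^sup>2) \<partial>circle_measure)"
      by (intro nn_integral_mono) (simp add: pw del: ennreal_numeral flip: ennreal_mult ennreal_plus)
    also have "\<dots> = ennreal (2 * c\<^sup>2) * ?I a f N + 2 * ?I b g N"
      by (simp add: nn_integral_add nn_integral_cmult)
    finally show ?thesis .
  qed
  have "(\<lambda>N. ennreal (2 * c\<^sup>2) * ?I a f N + 2 * ?I b g N) \<longlonglongrightarrow> ennreal (2 * c\<^sup>2) * 0 + 2 * 0"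
    using assms by (intro tendsto_add ennreal_tendsto_cmult) (auto simp: is_ztransform_iff)
  then have "(\<lambda>N. ennreal (2 * c\<^sup>2) * ?I a f N + 2 * ?I b g N) \<longlonglongrightarrow> 0" by simp
  from tendsto_sandwich[OF always_eventually always_eventually tendsto_const this]
  have "?I (\<lambda>k. c *\<^sub>R a k - b k) (\<lambda>z. c *\<^sub>R f z - g z) \<longlonglongrightarrow> 0"
    using le by simp
  then show ?thesis
    by (simp add: is_ztransform_iff)
qed

lemma measurable_cis_powi_smult [measurable]:
  fixes f :: "real \<Rightarrow> complex^'n"
  assumes [measurable]: "f \<in> borel_measurable circle_measure"
  shows "(\<lambda>\<omega>. cis \<omega> powi j *s f \<omega>) \<in> borel_measurable circle_measure"
proof -
  have "continuous_on UNIV (\<lambda>p :: complex \<times> (complex^'n). fst p *s snd p)"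
    unfolding vector_scalar_mult_def by (intro continuous_intros)
  then have [measurable]: "(\<lambda>p :: complex \<times> (complex^'n). fst p *s snd p) \<in> borel_measurable (borel \<Otimes>\<^sub>M borel)"
    by (simp add: borel_prod borel_measurable_continuous_onI)
  have "continuous_on UNIV (\<lambda>\<omega>. cis \<omega> powi j)"
    unfolding cis_power_int by (intro continuous_intros continuous_on_cis)
  then have "(\<lambda>\<omega>. cis \<omega> powi j) \<in> borel_measurable circle_measure"
    by (intro measurable_restrict_space1) (auto intro: borel_measurable_continuous_onI)
  then have "(\<lambda>\<omega>. (\<lambda>p :: complex \<times> (complex^'n). fst p *s snd p) (cis \<omega> powi j, f \<omega>)) \<in> borel_measurable circle_measure"
    by measurable
  then show ?thesis by simp
qed

text \<open>Multiplication by \<open>cis \<omega> powi j\<close> preserves norms, so the shifted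
  partial sums still converge in \<open>L2\<close>, and continuity of the inner product passes to
  the limit. Both partial sums use the same window \<open>{..<N}\<close>.\<close>

lemma ztransform_parseval:
  fixes a b :: "nat \<Rightarrow> real^'n"
  assumes "is_ztransform a f" "is_ztransform b g"
  shows "integrable circle_measure (\<lambda>\<omega>. f (cis \<omega>) \<bullet> (cis \<omega> powi j *s g (cis \<omega>)))"
    and "(\<lambda>N. 2 * pi * (\<Sum>k<N. \<Sum>l<N. if int l = int k + j then a k \<bullet> b l else 0))
      \<longlonglongrightarrow> (\<integral>\<omega>. f (cis \<omega>) \<bullet> (cis \<omega> powi j *s g (cis \<omega>)) \<partial>circle_measure)"
proof -
  have meas [measurable]: "(\<lambda>\<omega>. f (cis \<omega>)) \<in> borel_measurable circle_measure"
      "(\<lambda>\<omega>. g (cis \<omega>)) \<in> borel_measurable circle_measure"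
    and limf: "(\<lambda>N. \<integral>\<^sup>+\<omega>. ennreal ((norm (f (cis \<omega>) - trig_poly a {..<N} (cis \<omega>)))\<^sup>2) \<partial>circle_measure) \<longlonglongrightarrow> 0"
    and limg: "(\<lambda>N. \<integral>\<^sup>+\<omega>. ennreal ((norm (g (cis \<omega>) - trig_poly b {..<N} (cis \<omega>)))\<^sup>2) \<partial>circle_measure) \<longlonglongrightarrow> 0"
    using assms by (simp_all add: is_ztransform_iff)
  have norm_cis: "norm (cis \<omega> powi j *s x) = norm x" for \<omega> and x :: "complex^'n"
    by (simp add: norm_vector_smult_complex norm_power_int)
  have limg': "(\<lambda>N. \<integral>\<^sup>+\<omega>. ennreal ((norm (cis \<omega> powi j *s g (cis \<omega>) - cis \<omega> powi j *s trig_poly b {..<N} (cis \<omega>)))\<^sup>2)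
      \<partial>circle_measure) \<longlonglongrightarrow> 0"
    using limg by (simp add: norm_cis flip: vector_sub_rdistrib vector_ssub_ldistrib)
  have meas_cis: "(\<lambda>\<omega>. cis \<omega> powi j *s g (cis \<omega>)) \<in> borel_measurable circle_measure"
    "(\<lambda>\<omega>. cis \<omega> powi j *s trig_poly b {..<N} (cis \<omega>)) \<in> borel_measurable circle_measure" for N
    by measurable
  have int_cis: "integrable circle_measure (\<lambda>\<omega>. (norm (cis \<omega> powi j *s trig_poly b {..<N} (cis \<omega>)))\<^sup>2)" for N
    by (simp add: norm_cis integrable_norm2_trig_poly)
  show "integrable circle_measure (\<lambda>\<omega>. f (cis \<omega>) \<bullet> (cis \<omega> powi j *s g (cis \<omega>)))"
    by (intro integrable_inner_square_integrable meas meas_cis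
        L2_limit_square_integrable[OF meas(1) measurable_trig_poly integrable_norm2_trig_poly limf]
        L2_limit_square_integrable[OF meas_cis int_cis limg'])
  show "(\<lambda>N. 2 * pi * (\<Sum>k<N. \<Sum>l<N. if int l = int k + j then a k \<bullet> b l else 0))
      \<longlonglongrightarrow> (\<integral>\<omega>. f (cis \<omega>) \<bullet> (cis \<omega> powi j *s g (cis \<omega>)) \<partial>circle_measure)"
    using L2_limit_integral_inner_tendsto[OF meas(1) measurable_trig_poly integrable_norm2_trig_poly limf
        meas_cis int_cis limg']
    by (simp add: integral_inner_trig_poly)
qed

text \<open>Expanding the square in \<open>ineq\<close> leaves the mixed term
  \<open>g x \<bullet> g y\<close>, which joins \<open>(L - m) *\<^sub>R x\<close> on the left,
  while the half squares are absorbed into \<open>V\<close>.\<close>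

lemma S_class_potential:
  fixes H :: "real^'n \<Rightarrow> real"
  assumes "H \<in> S_class m L" "0 < m" "m \<le> L"
  defines "g \<equiv> \<lambda>y. grad H (y + minimizer H) - m *\<^sub>R y"
  obtains V where "\<And>y. 0 \<le> V y" "\<And>y. V y \<le> g y \<bullet> ((L - m) *\<^sub>R y - g y)"
    and "\<And>x y. g y \<bullet> ((L - m) *\<^sub>R x - g x) \<le> g y \<bullet> ((L - m) *\<^sub>R y - g y) - V y + V x"
    and "\<And>y. norm (g y) \<le> (L + m) * norm y"
proof -
  have G: "GDERIV H x :> grad H x" for x
    using assms(1) by (intro GDERIV_grad) (simp add: S_class_def C2_def)
  have mono: "m * (norm (x - y))\<^sup>2 \<le> (grad H x - grad H y) \<bullet> (x - y)" for x y
    using assms(1) by (simp add: S_class_def)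
  have lip: "norm (grad H x - grad H y) \<le> L * norm (x - y)" for x y
    using assms(1) by (simp add: S_class_def)
  define z where "z = minimizer H"
  have z: "grad H z = 0"
    unfolding z_def using G mono \<open>0 < m\<close> by (rule grad_minimizer)
  have g: "g y = grad H (y + z) - m *\<^sub>R y" for y by (simp add: g_def z_def)
  have g0: "g 0 = 0" by (simp add: g z)
  \<comment> \<open>Shifting by the minimizer gives \<open>g 0 = 0\<close> and subtracting
    \<open>H z\<close> gives \<open>h 0 = 0\<close>; together they make \<open>V\<close> vanish at
    the origin.\<close>
  define h where "h y = H (y + z) - m / 2 * (norm y)\<^sup>2 - H z" for y
  have h0: "h 0 = 0" by (simp add: h_def)
  have h: "GDERIV h y :> g y" for y
  proof -
    have "((\<lambda>y. y + z) has_derivative (\<lambda>v. v)) (at y)"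
      by (auto intro!: derivative_eq_intros)
    from has_derivative_compose[OF this G[unfolded gderiv_def]]
    have "GDERIV (\<lambda>y. H (y + z)) y :> grad H (y + z)"
      by (simp add: gderiv_def)
    from GDERIV_diff[OF GDERIV_diff[OF this GDERIV_norm_power2[of m]] GDERIV_const[of "H z"]]
    show ?thesis by (simp add: h_def[abs_def] g)
  qed
  have g_diff: "(g x - g y) \<bullet> (x - y) = (grad H (x + z) - grad H (y + z)) \<bullet> ((x + z) - (y + z)) - m * (norm (x - y))\<^sup>2" for x y
    by (simp add: g power2_norm_eq_inner algebra_simps)
  have ineq: "(norm (g x - g y))\<^sup>2 / 2 \<le> (L - m) * (h x - h y - g y \<bullet> (x - y))" for x y
  proof (rule smooth_monotone_gradient_ineq[OF h])
    show "0 \<le> (g x - g y) \<bullet> (x - y)" for x y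
      using mono[of "x + z" "y + z"] by (simp add: g_diff)
    show "(g x - g y) \<bullet> (x - y) \<le> (L - m) * (norm (x - y))\<^sup>2" for x y
    proof -
      have "(grad H (x + z) - grad H (y + z)) \<bullet> (x - y) \<le> norm (grad H (x + z) - grad H (y + z)) * norm (x - y)"
        by (rule norm_cauchy_schwarz)
      also have "\<dots> \<le> L * norm (x - y) * norm (x - y)"
        using lip[of "x + z" "y + z"] by (intro mult_right_mono) auto
      finally show ?thesis unfolding g_diff by (simp add: power2_eq_square left_diff_distrib)
    qed
  qed (use \<open>m \<le> L\<close> in simp)
  define V where "V y = (L - m) * h y - (norm (g y))\<^sup>2 / 2" for y
  have V: "g y \<bullet> ((L - m) *\<^sub>R x - g x) \<le> g y \<bullet> ((L - m) *\<^sub>R y - g y) - V y + V x" for x y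
    using ineq[of x y]
    by (simp add: V_def power2_norm_eq_inner inner_diff_left inner_diff_right inner_commute
        algebra_simps diff_divide_distrib add_divide_distrib)
  have V0: "V 0 = 0" by (simp add: V_def h0 g0)
  show thesis
  proof
    show "0 \<le> V y" for y
      using ineq[of y 0] by (simp add: V_def h0 g0)
    \<comment> \<open>Here \<open>x\<close> is set to 0, where \<open>g\<close> and \<open>V\<close>
      vanish, so the left side of the inequality is 0.\<close>
    show "V y \<le> g y \<bullet> ((L - m) *\<^sub>R y - g y)" for y
      using V[of y 0] by (simp add: V0 g0)
    show "norm (g y) \<le> (L + m) * norm y" for y
      using lip[of "y + z" z] norm_triangle_ineq4[of "grad H (y + z)" "m *\<^sub>R y"] \<open>0 < m\<close>
      by (simp add: g z algebra_simps)
  qed (rule V)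
qed

theorem theorem4:
  fixes m L \<rho> :: real
    and \<Delta> :: "(nat \<Rightarrow> real^'n) \<Rightarrow> (nat \<Rightarrow> real^'n)"
    and P :: "complex \<Rightarrow> complex^('n + 'n)^('n + 'n)"
  assumes "0 < m" and "m \<le> L"
    and "0 < \<rho>" and "\<rho> \<le> 1"
    and "\<Delta> \<in> Delta_set \<rho> m L"
    and "P \<in> Pi_set \<rho> m L"
  shows "satisfies_IQC \<Delta> P"
proof -
  obtain H where H: "H \<in> S_class m L" and \<Delta>: "\<Delta> = rho_minus \<rho> \<circ> Delta_op m H \<circ> rho_plus \<rho>"
    using assms(5) by (auto simp: Delta_set_def)
  obtain lp lm M where M: "M \<in> M_set \<rho> lp lm" and P: "P = (\<lambda>z. transpose (W_mat m L) **
      block_mat 0 (ctranspose (E_fun lp lm M z)) (E_fun lp lm M z) 0 ** W_mat m L)"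
    using assms(6) unfolding Pi_set_def by blast
  define J where "J = {- int lm..int lp}"
  obtain c where c: "\<And>j. j \<in> J \<Longrightarrow> M j = mat (c j)" "\<And>j. j \<in> J \<Longrightarrow> j \<noteq> 0 \<Longrightarrow> c j \<le> 0"
      "0 \<le> (\<Sum>j\<in>J. \<rho> powi (- j) * c j)" "0 \<le> (\<Sum>j\<in>J. \<rho> powi j * c j)"
    using M_set_cases[OF M, folded J_def] by metis
  define g where "g y = grad H (y + minimizer H) - m *\<^sub>R y" for y
  define u where "u y = (L - m) *\<^sub>R y - g y" for y
  obtain V where V: "\<And>y. 0 \<le> V y" "\<And>y. V y \<le> g y \<bullet> u y"
      "\<And>x y. g y \<bullet> u x \<le> g y \<bullet> u y - V y + V x"
    and bound: "\<And>y. norm (g y) \<le> (L + m) * norm y"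
    using S_class_potential[OF H assms(1,2)] unfolding g_def u_def by metis
  have \<Delta>_nth: "\<Delta> q k = \<rho> powi (- int k) *\<^sub>R g (\<rho> ^ k *\<^sub>R q k)" for q k
    by (simp add: \<Delta> rho_minus_def Delta_op_def rho_plus_def g_def)
  \<comment> \<open>The bound on \<open>g\<close> is homogeneous, so the weights
    \<open>\<rho> ^ k\<close> and \<open>\<rho> powi (- int k)\<close> cancel in it.\<close>
  have ell2: "\<Delta> q \<in> ell2" if "q \<in> ell2" for q
  proof -
    have "norm (\<Delta> q k) \<le> (L + m) * norm (q k)" for k
      using bound[of "\<rho> ^ k *\<^sub>R q k"] \<open>0 < \<rho>\<close>
      by (simp add: \<Delta>_nth power_int_minus field_simps)
    then have le: "norm ((norm (\<Delta> q k))\<^sup>2) \<le> (L + m)\<^sup>2 * (norm (q k))\<^sup>2" for k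
      using power_mono[of "norm (\<Delta> q k)" "(L + m) * norm (q k)" 2] by (simp add: power_mult_distrib)
    have "summable (\<lambda>k. (L + m)\<^sup>2 * (norm (q k))\<^sup>2)"
      using that by (simp add: ell2_def summable_mult)
    then have "summable (\<lambda>k. (norm (\<Delta> q k))\<^sup>2)"
      by (rule summable_comparison_test'[where N = 0]) (rule le)
    then show ?thesis by (simp add: ell2_def)
  qed
  have "set_integrable lborel {0..2*pi} f \<and> 0 \<le> (LINT \<omega>:{0..2*pi}|lborel. f \<omega>)"
    if q: "q \<in> ell2" and f: "f = (\<lambda>\<omega>. quad_form (P (cis \<omega>))
        (block_vec (ztransform q (cis \<omega>)) (ztransform (\<Delta> q) (cis \<omega>))))" for q f
  proof -
    define b where "b = \<Delta> q"
    \<comment> \<open>The time-domain counterpart of the first component produced by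
      \<open>W_mat\<close>.\<close>
    define a where "a k = (L - m) *\<^sub>R q k - b k" for k
    have b: "is_ztransform b (ztransform b)"
      unfolding b_def by (intro is_ztransform_ztransform ell2 q)
    have a: "is_ztransform a (\<lambda>z. (L - m) *\<^sub>R ztransform q z - ztransform b z)"
      unfolding a_def by (intro is_ztransform_scaleR_diff is_ztransform_ztransform q b)
    define F where "F j \<omega> = ztransform b (cis \<omega>) \<bullet> (cis \<omega> powi j *s ((L - m) *\<^sub>R ztransform q (cis \<omega>) - ztransform b (cis \<omega>)))" for j \<omega>
    have F: "integrable circle_measure (F j)"
      and lim: "(\<lambda>N. 2 * pi * (\<Sum>k<N. \<Sum>l<N. if int l = int k + j then b k \<bullet> a l else 0))
        \<longlonglongrightarrow> integral\<^sup>L circle_measure (F j)" for j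
      unfolding F_def using ztransform_parseval[OF b a, of j] by auto
    have f': "f = (\<lambda>\<omega>. complex_of_real (2 * (\<Sum>j\<in>J. c j * F j \<omega>)))"
      unfolding f P F_def b_def J_def
      by (intro ext quad_form_multiplier) (use c(1) J_def in blast)
    have "0 \<le> (\<Sum>j\<in>J. c j * (\<Sum>k<N. \<Sum>l<N. if int l = int k + j then b k \<bullet> a l else 0))" for N
    proof -
      define y where "y k = \<rho> ^ k *\<^sub>R q k" for k
      \<comment> \<open>The supply \<open>g \<bullet> u\<close> is split into supply minus
        \<open>V\<close> and \<open>V\<close>. Dividing by \<open>(\<rho> ^ k)\<^sup>2\<close> fits
        the weights: \<open>\<rho> powi (int k - int l) / (\<rho> ^ k)\<^sup>2\<close> equals
        \<open>1 / (\<rho> ^ k * \<rho> ^ l)\<close>, the factor in \<open>ba\<close>, and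
        symmetrically for \<open>\<beta> l\<close>.\<close>
      define \<alpha> where "\<alpha> k = (g (y k) \<bullet> u (y k) - V (y k)) / (\<rho> ^ k)\<^sup>2" for k
      define \<beta> where "\<beta> k = V (y k) / (\<rho> ^ k)\<^sup>2" for k
      have bk: "b k = (1 / \<rho> ^ k) *\<^sub>R g (y k)" for k
        by (simp add: b_def \<Delta>_nth y_def power_int_minus inverse_eq_divide)
      have ak: "a k = (1 / \<rho> ^ k) *\<^sub>R u (y k)" for k
        using \<open>0 < \<rho>\<close> by (simp add: a_def bk u_def y_def scaleR_diff_right)
      have ba: "b k \<bullet> a l = (g (y k) \<bullet> u (y l)) / (\<rho> ^ k * \<rho> ^ l)" for k l
        by (simp add: bk ak)
      show ?thesis
      proof (rule weighted_shift_sum_nonneg[where \<rho> = \<rho> and \<alpha> = \<alpha> and \<beta> = \<beta>])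
        show "0 \<le> \<alpha> k" "0 \<le> \<beta> k" for k
          using V(1,2) by (simp_all add: \<alpha>_def \<beta>_def)
        show "b k \<bullet> a k = \<alpha> k + \<beta> k" for k
          by (simp add: ba \<alpha>_def \<beta>_def power2_eq_square flip: add_divide_distrib)
        show "b k \<bullet> a l \<le> \<rho> powi (int k - int l) * \<alpha> k + \<rho> powi (int l - int k) * \<beta> l" for k l
        proof -
          have "b k \<bullet> a l \<le> (g (y k) \<bullet> u (y k) - V (y k) + V (y l)) / (\<rho> ^ k * \<rho> ^ l)"
            unfolding ba using V(3) \<open>0 < \<rho>\<close> by (intro divide_right_mono) auto
          also have "\<dots> = \<rho> powi (int k - int l) * \<alpha> k + \<rho> powi (int l - int k) * \<beta> l"
            using \<open>0 < \<rho>\<close>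
            by (simp add: \<alpha>_def \<beta>_def power_int_diff power2_eq_square field_simps)
          finally show ?thesis .
        qed
      qed (use c \<open>0 < \<rho>\<close> in auto)
    qed
    then have pos: "0 \<le> (\<Sum>j\<in>J. c j * (2 * pi * (\<Sum>k<N. \<Sum>l<N. if int l = int k + j then b k \<bullet> a l else 0)))" for N
      by (simp add: mult.left_commute[of _ "2 * pi"] flip: sum_distrib_left)
    have "(\<lambda>N. \<Sum>j\<in>J. c j * (2 * pi * (\<Sum>k<N. \<Sum>l<N. if int l = int k + j then b k \<bullet> a l else 0)))
        \<longlonglongrightarrow> (\<Sum>j\<in>J. c j * integral\<^sup>L circle_measure (F j))"
      by (intro tendsto_sum tendsto_mult tendsto_const lim)
    then have "0 \<le> (\<Sum>j\<in>J. c j * integral\<^sup>L circle_measure (F j))"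
      using pos by (intro LIMSEQ_le_const) auto
    also have "\<dots> = (\<integral>\<omega>. (\<Sum>j\<in>J. c j * F j \<omega>) \<partial>circle_measure)"
      using F by simp
    finally have "0 \<le> integral\<^sup>L circle_measure f"
      unfolding f' integral_complex_of_real by (simp add: less_eq_complex_def)
    moreover have "integrable circle_measure f"
      unfolding f' using F by simp
    ultimately show ?thesis
      by (simp add: set_integrable_def set_lebesgue_integral_def integrable_restrict_space integral_restrict_space)
  qed
  then show ?thesis
    unfolding satisfies_IQC_def Let_def using ell2 by blast
qed

end
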